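(* Let $K$ be a field of characteristic $0$ with henselian valuation ring $A$, valuation $v$ and residue field $k$ of characteristic $p>0$, and assume $K$ contains a primitive $p$-th root of unity $\zeta$. Let $L=K(\alpha)$ be a non-trivial Kummer extension with $\alpha^p=h\in K^\times$, let $B$ be the integral closure of $A$ in $L$, let $\sigma$ be the generator of $\mathrm{Gal}(L|K)$ with $\sigma(\alpha)=\zeta\alpha$, and let $N=N_{L|K}$ be the norm. Put $\mathfrak{z}=\zeta-1$. Then $$\mathcal{H}=\mathcal{N}_\sigma$$ as ideals of $A$, where $\mathcal{H}$ and $\mathcal{N}_\sigma$ are defined below.
   Context: $B$ is a valuation ring (since $A$ is henselian). Let $\mathfrak{A}$ be the set of $h\in K$ such that the solutions of $X^p=h$ generate $L$ over $K$. Define the ideal $\mathcal{J}_\sigma$ of $B$ generated by $\{\sigma(b)/b-1 : b\in L^\times\}$, the ideal $\mathcal{H}$ of $A$ generated by $\{\mathfrak{z}^p/(h-1): h\in\mathfrak{A}\}$, and the ideal $\mathcal{N}_\sigma$ of $A$ generated by $N(\mathcal{J}_\sigma)$. *)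

theory Defs
  imports "HOL-Computational_Algebra.Polynomial"
begin

definition subfield :: "'a::field set \<Rightarrow> bool" where
  "subfield F \<longleftrightarrow> 0 \<in> F \<and> 1 \<in> F \<and>
     (\<forall>x\<in>F. \<forall>y\<in>F. x + y \<in> F \<and> x * y \<in> F) \<and>
     (\<forall>x\<in>F. - x \<in> F \<and> inverse x \<in> F)"

definition adjoin :: "'a::field set \<Rightarrow> 'a set \<Rightarrow> 'a set" where
  "adjoin K S = \<Inter>{F. subfield F \<and> K \<subseteq> F \<and> S \<subseteq> F}"

definition valuation_ring :: "'a::field set \<Rightarrow> 'a set \<Rightarrow> bool" where
  "valuation_ring K A \<longleftrightarrow> subfield K \<and> A \<subseteq> K \<and> 0 \<in> A \<and> 1 \<in> A \<and>
     (\<forall>x\<in>A. \<forall>y\<in>A. x + y \<in> A \<and> x * y \<in> A) \<and> (\<forall>x\<in>A. - x \<in> A) \<and>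
     (\<forall>x\<in>K. x \<in> A \<or> inverse x \<in> A)"

definition max_ideal :: "'a::field set \<Rightarrow> 'a set" where
  "max_ideal A = {x \<in> A. x = 0 \<or> inverse x \<notin> A}"

definition henselian :: "'a::field set \<Rightarrow> bool" where
  "henselian A \<longleftrightarrow>
     (\<forall>f :: 'a poly. (\<forall>i. coeff f i \<in> A) \<and> lead_coeff f = 1 \<longrightarrow>
       (\<forall>a\<in>A. poly f a \<in> max_ideal A \<and> poly (pderiv f) a \<notin> max_ideal A \<longrightarrow>
          (\<exists>b\<in>A. poly f b = 0 \<and> b - a \<in> max_ideal A)))"

definition int_closure :: "'a::field set \<Rightarrow> 'a set \<Rightarrow> 'a set" where
  "int_closure A L = {b \<in> L. \<exists>f :: 'a poly. (\<forall>i. coeff f i \<in> A) \<and> lead_coeff f = 1 \<and> poly f b = 0}"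

definition gen_module :: "'a::field set \<Rightarrow> 'a set \<Rightarrow> 'a set" where
  "gen_module R S = {x. \<exists>(n::nat) (c::nat \<Rightarrow> 'a) (g::nat \<Rightarrow> 'a). (\<forall>i<n. c i \<in> R \<and> g i \<in> S) \<and> x = (\<Sum>i<n. c i * g i)}"

definition gal :: "'a::field set \<Rightarrow> 'a set \<Rightarrow> ('a \<Rightarrow> 'a) set" where
  "gal K L = {\<tau>. bij_betw \<tau> L L \<and>
      (\<forall>x\<in>L. \<forall>y\<in>L. \<tau> (x + y) = \<tau> x + \<tau> y \<and> \<tau> (x * y) = \<tau> x * \<tau> y) \<and>
      (\<forall>x\<in>K. \<tau> x = x) \<and> (\<forall>x. x \<notin> L \<longrightarrow> \<tau> x = x)}"

definition field_norm :: "'a::field set \<Rightarrow> 'a set \<Rightarrow> 'a \<Rightarrow> 'a" where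
  "field_norm K L b = (\<Prod>\<tau>\<in>gal K L. \<tau> b)"

definition kummer_gens :: "'a::field set \<Rightarrow> 'a set \<Rightarrow> nat \<Rightarrow> 'a set" where
  "kummer_gens K L p = {g \<in> K. adjoin K {x. x ^ p = g} = L}"

end

theory Submission
  imports Defs "HOL-Computational_Algebra.Primes"
begin

text \<open>
  Write \<open>z = \<zeta> - 1\<close>. Extend \<open>A\<close> to a valuation ring of \<open>L\<close>; Hensel's lemma forces it to be
  stable under \<open>\<sigma>\<close>, so it equals \<open>B\<close>, and every element of \<open>\<J>\<^sub>\<sigma>\<close> is a \<open>B\<close>-multiple of a single
  \<open>\<sigma> b / b - 1\<close>. If \<open>\<beta> ^ p = g\<close> and \<open>\<sigma> \<beta> = \<omega> \<beta>\<close>, then the norm of \<open>\<sigma> (\<beta> - c) / (\<beta> - c) - 1\<close> is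
  \<open>(\<omega> - 1) ^ p g / (g - c ^ p)\<close>. For \<open>1 / g\<close> and \<open>c = 1\<close> this puts the generators of \<open>\<H>\<close> in \<open>\<N>\<^sub>\<sigma>\<close>, and for
  \<open>\<beta> = \<alpha>\<close> it puts the norms of all \<open>\<sigma> (\<alpha> - a) / (\<alpha> - a) - 1\<close> with \<open>a \<in> K\<close> in \<open>\<H>\<close>. It remains to see that these
  elements generate \<open>\<J>\<^sub>\<sigma>\<close>. Unless one of them is a unit, any \<open>b = f \<alpha>\<close> with \<open>degree f < p\<close> has an
  expansion in powers of \<open>y = \<alpha> - a\<close>, for some \<open>a \<in> K\<close>, none of whose terms has smaller value than \<open>b\<close>;
  comparing \<open>\<sigma> b - b\<close> with \<open>b\<close> term by term, \<open>\<sigma> y / y - 1\<close> divides \<open>\<sigma> b / b - 1\<close>.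
\<close>

section \<open>Polynomials over subrings and valuation rings\<close>

text \<open>No value group is introduced: \<open>x / y \<in> B\<close> says that \<open>x\<close>
  has at least the value of \<open>y\<close>, so valuations of every rank are treated alike, as are
  ramified, inseparable-residue and defect extensions. The obstacle is that \<alpha> need not have a
  best approximation in K, so no single \<alpha> - a need serve all of L; the center
  \<open>a\<close> is chosen only after \<open>b\<close>. If every \<sigma> (\<alpha> - a) /
  (\<alpha> - a) - 1 lies in the maximal ideal, \<sigma> acts trivially on the residues that occur,
  and \<open>degree f < p\<close> makes all positive multiplicities and their factorials units; this
  is what allows Hensel's lemma to be applied to derivatives. If one of these elements is a unit, it
  divides everything, because \<sigma> preserves values and so \<sigma> b / b - 1 \<in> B. The
  comparison rests on \<sigma> y ^ i - y ^ i = y ^ i (\<rho> ^ i - 1) with \<rho> = \<sigma> y / y,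
  where \<rho> - 1 divides \<rho> ^ i - 1.\<close>

lemma coeff_pcompose_shift:
  fixes f :: "'a::field_char_0 poly"
  shows "coeff (pcompose f [:a, 1:]) k
       = (\<Sum>i\<le>degree f. coeff f i * (of_nat (i choose k) * a ^ (i - k)))"
proof -
  have "pcompose f [:a, 1:] = (\<Sum>i\<le>degree f. smult (coeff f i) ([:a, 1:] ^ i))"
    by (rule poly_ext) (simp add: poly_pcompose poly_sum poly_altdef[of f])
  moreover have "coeff ([:a, 1:] ^ i) k = of_nat (i choose k) * a ^ (i - k)" for i
  proof (cases "k \<le> i")
    case True then show ?thesis by (simp add: coeff_linear_poly_power)
  next
    case False
    then have "degree ([:a, 1:] ^ i) < k"
      using degree_power_le[of "[:a, 1:]" i] by simp
    with False show ?thesis by (simp add: coeff_eq_0)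
  qed
  ultimately show ?thesis by (simp add: coeff_sum)
qed

text \<open>Taylor's formula. It lets Hensel's lemma, applied to a higher derivative, make one
  chosen Taylor coefficient vanish.\<close>

lemma fact_mult_coeff_shift:
  fixes f :: "'a::field_char_0 poly"
  shows "poly ((pderiv ^^ k) f) a = fact k * coeff (pcompose f [:a, 1:]) k"
proof -
  have 1: "(pderiv ^^ k) (pcompose f [:a, 1:]) = pcompose ((pderiv ^^ k) f) [:a, 1:]"
    by (induction k) (simp_all add: pderiv_pcompose pderiv_pCons)
  have 2: "coeff ((pderiv ^^ k) g) n = pochhammer (of_nat (Suc n)) k * coeff g (n + k)" for g :: "'a poly" and n
  proof (induction k arbitrary: n)
    case (Suc k)
    show ?case
      by (simp add: coeff_pderiv Suc pochhammer_rec algebra_simps)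
  qed simp
  have "poly ((pderiv ^^ k) f) a = coeff (pcompose ((pderiv ^^ k) f) [:a, 1:]) 0"
    by simp
  also have "\<dots> = fact k * coeff (pcompose f [:a, 1:]) k"
    unfolding 1[symmetric] 2 by (simp add: pochhammer_fact)
  finally show ?thesis .
qed

lemma poly_shift_expand:
  fixes f :: "'a::field_char_0 poly"
  shows "poly f x = (\<Sum>i\<le>degree f. coeff (pcompose f [:a, 1:]) i * (x - a) ^ i)"
proof -
  have "poly f x = poly (pcompose f [:a, 1:]) (x - a)"
    by (simp add: poly_pcompose)
  also have "\<dots> = (\<Sum>i\<le>degree f. coeff (pcompose f [:a, 1:]) i * (x - a) ^ i)"
    by (simp add: poly_altdef degree_pcompose)
  finally show ?thesis .
qed

section \<open>Subrings, subfields and valuation rings inside one ambient field\<close>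

locale subring =
  fixes S :: "'a::field_char_0 set"
  assumes zero [simp]: "0 \<in> S" and one [simp]: "1 \<in> S"
    and add: "x \<in> S \<Longrightarrow> y \<in> S \<Longrightarrow> x + y \<in> S"
    and mult: "x \<in> S \<Longrightarrow> y \<in> S \<Longrightarrow> x * y \<in> S"
    and minus: "x \<in> S \<Longrightarrow> - x \<in> S"
begin

lemma diff: "x \<in> S \<Longrightarrow> y \<in> S \<Longrightarrow> x - y \<in> S"
  using add[of x "- y"] minus[of y] by simp

lemma power: "x \<in> S \<Longrightarrow> x ^ n \<in> S"
  by (induction n) (auto intro: mult)

lemma sum: "(\<And>i. i \<in> I \<Longrightarrow> g i \<in> S) \<Longrightarrow> (\<Sum>i\<in>I. g i) \<in> S"
  by (induction I rule: infinite_finite_induct) (auto intro: add)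

lemma prod: "(\<And>i. i \<in> I \<Longrightarrow> g i \<in> S) \<Longrightarrow> (\<Prod>i\<in>I. g i) \<in> S"
  by (induction I rule: infinite_finite_induct) (auto intro: mult)

lemma of_nat [simp]: "of_nat n \<in> S"
  by (induction n) (auto intro: add)

definition polys :: "'a poly set" where
  "polys = {f. \<forall>i. coeff f i \<in> S}"

lemma polysI: "(\<And>i. coeff f i \<in> S) \<Longrightarrow> f \<in> polys"
  by (simp add: polys_def)

lemma polysD: "f \<in> polys \<Longrightarrow> coeff f i \<in> S"
  by (simp add: polys_def)

lemma polys_0 [simp]: "0 \<in> polys" and polys_1 [simp]: "1 \<in> polys"
  by (auto simp: polys_def)

lemma polys_pCons: "a \<in> S \<Longrightarrow> f \<in> polys \<Longrightarrow> pCons a f \<in> polys"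
  by (auto simp: polys_def coeff_pCons split: nat.splits)

lemma polys_monom: "a \<in> S \<Longrightarrow> monom a n \<in> polys"
  by (auto simp: polys_def)

lemma polys_smult: "a \<in> S \<Longrightarrow> f \<in> polys \<Longrightarrow> smult a f \<in> polys"
  by (auto simp: polys_def mult)

lemma polys_add: "f \<in> polys \<Longrightarrow> g \<in> polys \<Longrightarrow> f + g \<in> polys"
  by (auto simp: polys_def add)

lemma polys_minus: "f \<in> polys \<Longrightarrow> - f \<in> polys"
  by (auto simp: polys_def minus)

lemma polys_diff: "f \<in> polys \<Longrightarrow> g \<in> polys \<Longrightarrow> f - g \<in> polys"
  by (auto simp: polys_def diff)

lemma polys_mult: "f \<in> polys \<Longrightarrow> g \<in> polys \<Longrightarrow> f * g \<in> polys"
  by (auto simp: polys_def coeff_mult intro!: sum mult)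

lemma polys_sum: "(\<And>i. i \<in> I \<Longrightarrow> g i \<in> polys) \<Longrightarrow> (\<Sum>i\<in>I. g i) \<in> polys"
  by (induction I rule: infinite_finite_induct) (auto intro: polys_add)

lemma polys_prod: "(\<And>i. i \<in> I \<Longrightarrow> g i \<in> polys) \<Longrightarrow> (\<Prod>i\<in>I. g i) \<in> polys"
  by (induction I rule: infinite_finite_induct) (auto intro: polys_mult)

lemma polys_pcompose: "f \<in> polys \<Longrightarrow> g \<in> polys \<Longrightarrow> pcompose f g \<in> polys"
  unfolding polys_def using coeff_pcompose_semiring_closed[of S f g] add mult by auto

lemma polys_pderiv: "f \<in> polys \<Longrightarrow> pderiv f \<in> polys"
  by (auto simp: polys_def coeff_pderiv simp del: of_nat_Suc intro!: mult)

lemma polys_higher_pderiv: "f \<in> polys \<Longrightarrow> (pderiv ^^ k) f \<in> polys"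
  by (induction k) (auto intro: polys_pderiv)

lemma poly_in: "f \<in> polys \<Longrightarrow> x \<in> S \<Longrightarrow> poly f x \<in> S"
  by (auto simp: poly_altdef polys_def intro!: sum mult power)

text \<open>A monic divisor makes long division free of inverses, so quotient and remainder stay
  over \<open>S\<close>.\<close>

lemma monic_division:
  assumes "f \<in> polys" "q \<in> polys" "lead_coeff q = 1" "0 < degree q"
  shows "\<exists>s\<in>polys. \<exists>r\<in>polys. f = q * s + r \<and> degree r < degree q"
  using assms(1)
proof (induction "degree f" arbitrary: f rule: less_induct)
  case less
  show ?case
  proof (cases "degree f < degree q")
    case True
    then show ?thesis using less.prems by (intro bexI[of _ 0] bexI[of _ f]) auto
  next
    case False
    define m where "m = monom (lead_coeff f) (degree f - degree q)"
    have m: "m \<in> polys"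
      unfolding m_def using less.prems by (intro polys_monom polysD)
    have f0: "f \<noteq> 0" using False assms(4) by auto
    have q0: "q \<noteq> 0" using assms(4) by auto
    have dm: "degree (q * m) = degree f"
      using False f0 q0 by (simp add: m_def degree_mult_eq degree_monom_eq)
    have "lead_coeff (q * m) = lead_coeff f"
      using assms(3) f0 by (simp add: lead_coeff_mult m_def degree_monom_eq)
    then have "coeff (f - q * m) (degree f) = 0" by (simp add: dm)
    moreover have "degree (f - q * m) \<le> degree f" using dm by (intro degree_diff_le) auto
    moreover have "0 < degree f" using False assms(4) by linarith
    ultimately have "degree (f - q * m) < degree f"
      by (metis degree_0 le_less leading_coeff_0_iff)
    moreover have "f - q * m \<in> polys"
      using less.prems m assms(2) by (intro polys_diff polys_mult)
    ultimately obtain s r where "s \<in> polys" "r \<in> polys" "f - q * m = q * s + r" "degree r < degree q"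
      using less.hyps by blast
    then show ?thesis
      using m by (intro bexI[of _ "s + m"] bexI[of _ r]) (auto simp: algebra_simps intro: polys_add)
  qed
qed

end

locale subfield_set =
  fixes F :: "'a::field_char_0 set"
  assumes subfield: "subfield F"
begin

sublocale subring F
  using subfield by unfold_locales (auto simp: subfield_def)

lemma inverse: "x \<in> F \<Longrightarrow> inverse x \<in> F"
  using subfield by (auto simp: subfield_def)

lemma divide: "x \<in> F \<Longrightarrow> y \<in> F \<Longrightarrow> x / y \<in> F"
  by (simp add: divide_inverse mult inverse)

end

locale vring =
  fixes F R :: "'a::field_char_0 set"
  assumes V: "valuation_ring F R"
begin

sublocale fld: subfield_set F
  using V by unfold_locales (auto simp: valuation_ring_def)

sublocale subring R
  using V by unfold_locales (auto simp: valuation_ring_def)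

abbreviation M where "M \<equiv> max_ideal R"

lemma sub: "x \<in> R \<Longrightarrow> x \<in> F"
  using V by (auto simp: valuation_ring_def)

lemma total: "x \<in> F \<Longrightarrow> x \<in> R \<or> inverse x \<in> R"
  using V by (auto simp: valuation_ring_def)

lemma M_R: "x \<in> M \<Longrightarrow> x \<in> R" by (simp add: max_ideal_def)

lemma zero_M [simp]: "0 \<in> M" by (simp add: max_ideal_def)

lemma one_notin_M [simp]: "1 \<notin> M" by (simp add: max_ideal_def)

lemma inverse_M: "x \<in> F \<Longrightarrow> x \<notin> R \<Longrightarrow> inverse x \<in> M"
  using total[of x] by (auto simp: max_ideal_def)

lemma inverse_unit: "x \<in> R \<Longrightarrow> x \<notin> M \<Longrightarrow> inverse x \<in> R"
  by (auto simp: max_ideal_def)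

lemma unit_nonzero: "x \<notin> M \<Longrightarrow> x \<noteq> 0" by auto

lemma M_mult: assumes "x \<in> M" "r \<in> R" shows "x * r \<in> M"
proof (cases "x * r = 0")
  case False
  have "inverse (x * r) \<notin> R"
  proof
    assume "inverse (x * r) \<in> R"
    then have "r * inverse (x * r) \<in> R" using assms mult by blast
    then have "inverse x \<in> R" using False by (simp add: field_simps)
    then show False using assms False by (auto simp: max_ideal_def)
  qed
  then show ?thesis using assms mult by (auto simp: max_ideal_def)
qed auto

lemma M_mult': "x \<in> M \<Longrightarrow> r \<in> R \<Longrightarrow> r * x \<in> M"
  using M_mult[of x r] by (simp add: mult.commute)

lemma M_minus: "x \<in> M \<Longrightarrow> - x \<in> M"
  using M_mult[of x "- 1"] minus by simp

text \<open>One of \<open>x / y\<close> and \<open>y / x\<close> lies in \<open>R\<close>; factoring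
  out the denominator leaves an element of \<open>M\<close> times an element of
  \<open>R\<close>.\<close>

lemma M_add: assumes "x \<in> M" "y \<in> M" shows "x + y \<in> M"
proof -
  have *: "x + y \<in> M" if "x \<in> M" "y \<in> M" "x / y \<in> R" "y \<noteq> 0" for x y
  proof -
    have "y * (x / y + 1) \<in> M" using that add by (intro M_mult) auto
    moreover have "y * (x / y + 1) = x + y" using that by (simp add: distrib_left)
    ultimately show ?thesis by simp
  qed
  show ?thesis
  proof (cases "x = 0 \<or> y = 0")
    case False
    have "x / y \<in> R \<or> y / x \<in> R"
      using total[of "x / y"] assms M_R sub fld.divide by fastforce
    then show ?thesis
      using *[of x y] *[of y x] assms False by (auto simp: add.commute)
  qed (use assms in auto)
qed

lemma M_diff: "x \<in> M \<Longrightarrow> y \<in> M \<Longrightarrow> x - y \<in> M"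
  using M_add[of x "- y"] M_minus by simp

lemma M_sum: "(\<And>i. i \<in> I \<Longrightarrow> g i \<in> M) \<Longrightarrow> (\<Sum>i\<in>I. g i) \<in> M"
  by (induction I rule: infinite_finite_induct) (auto intro: M_add)

lemma M_prime: assumes "x \<in> R" "y \<in> R" "x * y \<in> M" shows "x \<in> M \<or> y \<in> M"
proof (rule ccontr)
  assume *: "\<not> ?thesis"
  then have "x * y * inverse x * inverse y \<in> M"
    using M_mult[OF M_mult[OF assms(3) inverse_unit] inverse_unit] assms * by blast
  moreover have "x \<noteq> 0" "y \<noteq> 0" using * by auto
  then have "x * y * inverse x * inverse y = 1" by (simp add: field_simps)
  ultimately show False by simp
qed

lemma M_prod:
  assumes "finite I" "\<And>i. i \<in> I \<Longrightarrow> g i \<in> R" "(\<Prod>i\<in>I. g i) \<in> M"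
  shows "\<exists>i\<in>I. g i \<in> M"
  using assms by (induction I) (auto dest!: M_prime intro: prod)

lemma M_prodI:
  assumes "finite I" "\<And>i. i \<in> I \<Longrightarrow> g i \<in> R" "i \<in> I" "g i \<in> M"
  shows "(\<Prod>i\<in>I. g i) \<in> M"
  using assms by (subst prod.remove[of _ i]) (auto intro!: M_mult prod)

lemma M_power: "x \<in> R \<Longrightarrow> x ^ n \<in> M \<Longrightarrow> x \<in> M"
proof (induction n)
  case (Suc n)
  then show ?case using M_prime[of x "x ^ n"] power by auto
qed auto

lemma M_cong: "x - y \<in> M \<Longrightarrow> x \<in> M \<longleftrightarrow> y \<in> M"
  using M_add[of "x - y" y] M_diff[of x "x - y"] by auto

lemma M_cong_mult: "x - x' \<in> M \<Longrightarrow> y - y' \<in> M \<Longrightarrow> x' \<in> R \<Longrightarrow> y \<in> R \<Longrightarrow> x * y - x' * y' \<in> M"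
proof -
  assume "x - x' \<in> M" "y - y' \<in> M" "x' \<in> R" "y \<in> R"
  then have "(x - x') * y + x' * (y - y') \<in> M" by (intro M_add M_mult M_mult')
  then show ?thesis by (simp add: algebra_simps)
qed

lemma M_cong_prod:
  assumes "\<And>i. i \<in> I \<Longrightarrow> f i - g i \<in> M" "\<And>i. i \<in> I \<Longrightarrow> f i \<in> R" "\<And>i. i \<in> I \<Longrightarrow> g i \<in> R"
  shows "(\<Prod>i\<in>I. f i) - (\<Prod>i\<in>I. g i) \<in> M"
  using assms by (induction I rule: infinite_finite_induct) (auto intro!: M_cong_mult prod)

lemma M_cong_power: "x - y \<in> M \<Longrightarrow> x \<in> R \<Longrightarrow> y \<in> R \<Longrightarrow> x ^ n - y ^ n \<in> M"
  by (induction n) (auto intro: M_cong_mult power)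

lemma R_of_cong: "x - y \<in> M \<Longrightarrow> y \<in> R \<Longrightarrow> x \<in> R"
  using add[of "x - y" y] M_R by simp

lemma M_cong_poly:
  assumes "f \<in> polys" "x - y \<in> M" "x \<in> R" "y \<in> R"
  shows "poly f x - poly f y \<in> M"
proof -
  have "poly f x - poly f y = (\<Sum>i\<le>degree f. coeff f i * (x ^ i - y ^ i))"
    by (simp add: poly_altdef sum_subtractf algebra_simps)
  also have "\<dots> \<in> M"
    using assms by (intro M_sum M_mult' M_cong_power polysD)
  finally show ?thesis .
qed

text \<open>The quantities \<open>g j / g i\<close> below say that \<open>g i\<close> has the least value.\<close>

lemma exists_min_value:
  assumes "finite I" "I \<noteq> {}" "\<And>j. j \<in> I \<Longrightarrow> g j \<in> F" "\<exists>j\<in>I. g j \<noteq> 0"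
  shows "\<exists>i\<in>I. g i \<noteq> 0 \<and> (\<forall>j\<in>I. g j / g i \<in> R)"
proof -
  have "\<exists>i\<in>J. \<forall>j\<in>J. g j / g i \<in> R" if "finite J" "J \<noteq> {}" "J \<subseteq> I" "\<forall>j\<in>J. g j \<noteq> 0" for J
    using that
  proof (induction J rule: finite_ne_induct)
    case (insert k J)
    then obtain i where i: "i \<in> J" "\<forall>j\<in>J. g j / g i \<in> R" by auto
    have "g k / g i \<in> F" using i insert.prems assms(3) fld.divide by auto
    then consider "g k / g i \<in> R" | "g i / g k \<in> R" using total[of "g k / g i"] by auto
    then show ?case
    proof cases
      case 2
      have "g j / g k \<in> R" if "j \<in> J" for j
        using mult[OF i(2)[rule_format, OF that] 2] insert.prems i by (auto simp: field_simps)
      moreover have "g k / g k \<in> R" using insert.prems by auto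
      ultimately show ?thesis by blast
    qed (use i in auto)
  qed auto
  moreover have "finite {j\<in>I. g j \<noteq> 0}" "{j\<in>I. g j \<noteq> 0} \<noteq> {}" using assms(1,4) by auto
  ultimately have "\<exists>i\<in>{j\<in>I. g j \<noteq> 0}. \<forall>j\<in>{j\<in>I. g j \<noteq> 0}. g j / g i \<in> R" by blast
  then obtain i where
    i: "i \<in> I" "g i \<noteq> 0" "\<forall>j\<in>I. g j \<noteq> 0 \<longrightarrow> g j / g i \<in> R" by blast
  have "g j / g i \<in> R" if "j \<in> I" for j using i that by (cases "g j = 0") auto
  with i show ?thesis by blast
qed

text \<open>Valuation rings are integrally closed: for \<open>x\<close> outside \<open>R\<close>,
  dividing the equation by \<open>x ^ n\<close> writes 1 as minus a sum of terms that contain a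
  positive power of \<open>inverse x\<close>, which lies in \<open>M\<close>.\<close>

lemma monic_root_in_R:
  assumes "x \<in> F" "f \<in> polys" "lead_coeff f = 1" "poly f x = 0"
  shows "x \<in> R"
proof (rule ccontr)
  assume "x \<notin> R"
  then have M: "inverse x \<in> M" and x0: "x \<noteq> 0" using assms inverse_M by auto
  define n where "n = degree f"
  have "0 = poly f x * inverse x ^ n" using assms by simp
  also have "\<dots> = (\<Sum>i\<le>n. coeff f i * inverse x ^ (n - i))"
    unfolding poly_altdef n_def sum_distrib_right
  proof (intro sum.cong refl)
    fix i assume "i \<in> {..degree f}"
    then show "coeff f i * x ^ i * inverse x ^ degree f = coeff f i * inverse x ^ (degree f - i)"
      using x0 by (simp add: power_diff field_simps)
  qed
  also have "\<dots> = 1 + (\<Sum>i<n. coeff f i * inverse x ^ (n - i))"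
    using assms(3) unfolding lessThan_Suc_atMost[symmetric] sum.lessThan_Suc by (simp add: n_def)
  finally have "1 = - (\<Sum>i<n. coeff f i * inverse x ^ (n - i))"
    by (simp add: eq_neg_iff_add_eq_0)
  also have "\<dots> \<in> M"
  proof (intro M_minus M_sum M_mult' polysD assms)
    fix i assume "i \<in> {..<n}"
    then obtain k where "n - i = Suc k" by (metis lessThan_iff Suc_diff_Suc)
    then show "inverse x ^ (n - i) \<in> M" using M M_R by (auto intro!: M_mult power)
  qed
  finally show False by simp
qed

end

section \<open>Hensel's lemma and Chevalley's extension theorem\<close>

lemma inverse_power_mult_power:
  fixes x :: "'a::field"
  assumes "x \<noteq> 0" "i \<le> n" shows "inverse x ^ i * x ^ n = x ^ (n - i)"
  using assms by (simp add: power_diff power_inverse divide_inverse)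

context vring
begin

lemma residue_order:
  assumes "z \<in> R" "coprime m n" "z ^ m - 1 \<in> M" "z ^ n - 1 \<in> M" "n \<noteq> 1"
  shows "z - 1 \<in> M"
proof -
  obtain x y where xy: "m * x = n * y + 1"
    using coprime_bezout_strong assms by blast
  have "z ^ (n * y) - 1 \<in> M"
    using M_cong_power[OF assms(4), of y] assms(1) power by (simp add: power_mult)
  then have "z ^ (n * y) * z - 1 * z \<in> M"
    using M_mult[of "z ^ (n * y) - 1" z] assms(1) by (simp add: algebra_simps)
  moreover have "z ^ (n * y + 1) - 1 \<in> M"
    using M_cong_power[OF assms(3), of x] assms(1) power xy by (simp flip: power_mult)
  ultimately have "z ^ (n * y + 1) - 1 - (z ^ (n * y) * z - 1 * z) \<in> M"
    using M_diff by blast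
  then show ?thesis by (simp add: algebra_simps)
qed

lemma of_nat_coprime:
  assumes "of_nat m \<in> M" "coprime m n" "n \<noteq> 1"
  shows "of_nat n \<notin> M"
proof
  assume n: "of_nat n \<in> M"
  obtain x y where xy: "m * x = n * y + 1"
    using coprime_bezout_strong assms by blast
  have "of_nat m * of_nat x - of_nat n * of_nat y \<in> M"
    using assms n by (intro M_diff M_mult) auto
  also have "of_nat m * of_nat x - of_nat n * of_nat y = (of_nat (m * x) - of_nat (n * y) :: 'a)"
    by simp
  also have "\<dots> = 1" unfolding xy by simp
  finally show False by simp
qed

text \<open>If both sums vanish in the residue field, then \<open>z\<close> has residue 1 there and
  the sums are \<open>m\<close> and \<open>n\<close>, which cannot both vanish. So for each
  \<open>z\<close> at most one prime is bad, and finitely many \<open>z\<close> leave room for a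
  common good prime.\<close>

lemma geometric_sum_unit:
  assumes "z \<in> R" "prime m" "prime n" "m \<noteq> n"
    and "(\<Sum>k<m. z ^ k) \<in> M"
  shows "(\<Sum>k<n. z ^ k) \<notin> M"
proof
  assume n: "(\<Sum>k<n. z ^ k) \<in> M"
  have cop: "coprime m n" using assms primes_coprime by blast
  have *: "z ^ l - 1 \<in> M" if "(\<Sum>k<l. z ^ k) \<in> M" for l
    using M_mult[OF that, of "z - 1"] assms(1) diff
    by (simp add: power_diff_1_eq mult.commute)
  have "n \<noteq> 1" using assms(3) by auto
  then have 1: "z - 1 \<in> M"
    using residue_order[OF assms(1) cop *[OF assms(5)] *[OF n]] by auto
  have "of_nat l \<in> M" if "(\<Sum>k<l. z ^ k) \<in> M" for l
  proof -
    have "(\<Sum>k<l. z ^ k - 1 ^ k) \<in> M"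
      using 1 assms(1) by (intro M_sum M_cong_power) auto
    then have "(\<Sum>k<l. z ^ k) - of_nat l \<in> M" by (simp add: sum_subtractf)
    with that show ?thesis using M_cong by blast
  qed
  with n assms(5) of_nat_coprime[OF _ cop \<open>n \<noteq> 1\<close>] show False by auto
qed

text \<open>As \<open>g\<close> need not be monic, \<open>henselian\<close> does not apply directly. Substituting \<open>g\<^sub>0 / (g\<^sub>1 W)\<close> for the
  variable and clearing denominators gives a monic polynomial in \<open>W\<close> congruent to \<open>W^n + W^(n-1)\<close>.\<close>

lemma hensel_at_0:
  assumes hens: "henselian R" and g: "g \<in> polys" "coeff g 0 \<in> M" "coeff g 1 \<notin> M"
  shows "\<exists>x\<in>M. poly g x = 0"
proof (cases "coeff g 0 = 0")
  case True
  then show ?thesis by (intro bexI[of _ 0]) (auto simp: poly_0_coeff_0)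
next
  case False
  define n where "n = degree g"
  define g0 where "g0 = coeff g 0"
  define g1 where "g1 = coeff g 1"
  \<comment> \<open>\<open>- c\<close> is the first Newton approximation, so the root is sought as
    \<open>c / w\<close> with \<open>w\<close> near -1; \<open>e i\<close> below are the
    coefficients of g (c / W) W^n / g0.\<close>
  define c where "c = g0 / g1"
  have g1: "g1 \<in> R" "g1 \<notin> M" "g1 \<noteq> 0" using g by (auto simp: g1_def polysD)
  have g0: "g0 \<in> M" "g0 \<noteq> 0" using g False by (auto simp: g0_def)
  have c: "c \<in> M" unfolding c_def divide_inverse using g0 g1 by (intro M_mult inverse_unit)
  have n: "n \<ge> 1" using g1 le_degree[of g 1] by (auto simp: n_def g1_def)
  define e where "e i = coeff g i * c ^ i / g0" for i
  have e0: "e 0 = 1" and e1: "e 1 = 1"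
    using g0 g1 by (simp_all add: e_def c_def g0_def g1_def)
  have e_M: "e i \<in> M" if "i \<ge> 2" for i
  proof -
    obtain j where j: "i = Suc (Suc j)" using le_Suc_ex[OF \<open>i \<ge> 2\<close>] by auto
    \<comment> \<open>As \<open>c / g0 = inverse g1\<close>, one factor \<open>c\<close> absorbs the
      division by \<open>g0\<close> and another keeps the coefficient in \<open>M\<close>.\<close>
    have "e i = c * (coeff g i * c ^ j * inverse g1)"
      using g0 g1 by (simp add: e_def j c_def field_simps)
    also have "\<dots> \<in> M"
      using c M_R g1 g by (intro M_mult mult power inverse_unit polysD)
    finally show ?thesis .
  qed
  have e_R: "e i \<in> R" for i
    using e0 e1 e_M[of i] M_R by (cases "i = 0 \<or> i = 1") auto
  define P where "P = (\<Sum>i\<le>n. monom (e i) (n - i))"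
  define P2 where "P2 = (\<Sum>i\<in>{2..n}. monom (e i) (n - i))"
  have split: "{..n} = {0,1} \<union> {2..n}" using n by auto
  have P: "P = monom 1 n + monom 1 (n - 1) + P2"
    unfolding P_def P2_def split using e0 e1 by (subst sum.union_disjoint) auto
  have coeff_P2: "coeff P2 i \<in> M" for i
    unfolding P2_def coeff_sum by (intro M_sum) (auto intro: e_M)
  have P_polys: "P \<in> polys" unfolding P_def by (intro polys_sum polys_monom e_R)
  have "coeff P2 n = 0" unfolding P2_def coeff_sum by (intro sum.neutral) auto
  then have cn: "coeff P n = 1" using n by (auto simp: P)
  have "degree P \<le> n" unfolding P_def
    by (intro degree_sum_le) (auto intro: order.trans[OF degree_monom_le])
  with cn have lead: "lead_coeff P = 1"
    by (metis le_antisym le_degree zero_neq_one)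
  have m1: "- 1 \<in> R" using minus by auto
  have P2_M: "poly P2 (- 1) \<in> M" "poly (pderiv P2) (- 1) \<in> M"
    unfolding poly_altdef coeff_pderiv
    by (intro M_sum M_mult[OF coeff_P2 power[OF m1]]
        M_mult[OF M_mult'[OF coeff_P2 of_nat] power[OF m1]])+
  obtain n' where n': "n = Suc n'" using n by (cases n) auto
  have "poly P (- 1) = poly P2 (- 1)"
    by (simp add: P poly_monom n')
  then have "poly P (- 1) \<in> M" using P2_M by simp
  \<comment> \<open>At -1 the derivative of W^n + W^(n-1) is (-1)^(n-1), whatever the residue
    characteristic, so -1 is a simple root over the residue field.\<close>
  moreover have "poly (pderiv P) (- 1) - (- 1) ^ n' = poly (pderiv P2) (- 1)"
    by (cases n') (simp_all add: P pderiv_add pderiv_monom poly_monom n' algebra_simps)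
  then have "poly (pderiv P) (- 1) \<notin> M"
    using M_cong[of "poly (pderiv P) (- 1)" "(- 1) ^ n'"] P2_M M_power[OF m1, of n'] M_minus[of "-1"] by auto
  ultimately obtain w where w: "w \<in> R" "poly P w = 0" "w - (- 1) \<in> M"
    using hens P_polys lead m1 unfolding henselian_def polys_def by blast
  have wM: "w \<notin> M"
    using M_cong[OF w(3)] M_minus[of "-1"] by auto
  then have w0: "w \<noteq> 0" by auto
  have "poly g (c / w) = (\<Sum>i\<le>n. coeff g i * (c / w) ^ i)"
    by (simp add: poly_altdef n_def)
  also have "\<dots> = (\<Sum>i\<le>n. e i * w ^ (n - i)) * (g0 / w ^ n)"
    unfolding sum_distrib_right
  proof (intro sum.cong refl)
    fix i assume "i \<in> {..n}"
    then have "w ^ (n - i) = w ^ n / w ^ i" using w0 by (simp add: power_diff)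
    then show "coeff g i * (c / w) ^ i = e i * w ^ (n - i) * (g0 / w ^ n)"
      using w0 g0 by (simp add: e_def power_divide)
  qed
  also have "(\<Sum>i\<le>n. e i * w ^ (n - i)) = poly P w"
    by (simp add: P_def poly_sum poly_monom)
  finally have "poly g (c / w) = 0" using w by simp
  moreover have "c / w \<in> M"
    unfolding divide_inverse using c w wM by (intro M_mult inverse_unit)
  ultimately show ?thesis by blast
qed

lemma hensel_simple_root:
  assumes "henselian R" "g \<in> polys" "a \<in> R" "poly g a \<in> M" "poly (pderiv g) a \<notin> M"
  shows "\<exists>b\<in>R. poly g b = 0 \<and> b - a \<in> M"
proof -
  have "pcompose g [:a, 1:] \<in> polys"
    using assms by (intro polys_pcompose polys_pCons) auto
  moreover have "coeff (pcompose g [:a, 1:]) 0 \<in> M" using assms by simp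
  moreover have "coeff (pcompose g [:a, 1:]) 1 \<notin> M"
    using fact_mult_coeff_shift[of 1 g a] assms by simp
  ultimately obtain x where x: "x \<in> M" "poly (pcompose g [:a, 1:]) x = 0"
    using hensel_at_0[OF assms(1)] by blast
  then show ?thesis
    using assms M_R by (intro bexI[of _ "a + x"]) (auto simp: poly_pcompose add.commute intro: add)
qed

end

section \<open>Chevalley's theorem: subrings of \<open>L\<close> maximal with trace \<open>R\<close>
  on \<open>F\<close>\<close>

locale maximal_over = vring F R + L: subfield_set L + S: subring S
  for F R L S :: "'a::field_char_0 set" +
  assumes FL: "F \<subseteq> L" and SL: "S \<subseteq> L" and SF: "S \<inter> F = R"
    and maxi: "\<And>T. subring T \<Longrightarrow> S \<subseteq> T \<Longrightarrow> T \<subseteq> L \<Longrightarrow> T \<inter> F = R \<Longrightarrow> T = S"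
begin

text \<open>The ideal of \<open>S\<close> generated by \<open>M\<close>: since \<open>R\<close> is a
  valuation ring, a sum of products \<open>m * r\<close> is again one such product. The condition
  \<open>S \<inter> F = R\<close> keeps it proper and takes the place of a domination condition on
  local rings.\<close>

definition I where "I = {m * r | m r. m \<in> M \<and> r \<in> S}"

lemma RS: "R \<subseteq> S" using SF by auto

lemma I_mult: "x \<in> I \<Longrightarrow> s \<in> S \<Longrightarrow> x * s \<in> I"
  unfolding I_def using S.mult by (fastforce simp: mult.assoc)

lemma I_S: "x \<in> I \<Longrightarrow> x \<in> S"
  unfolding I_def using S.mult M_R RS by auto

lemma I_0 [simp]: "0 \<in> I"
  unfolding I_def mem_Collect_eq by (rule exI[of _ 0], rule exI[of _ 0]) simp

lemma I_add: assumes "x \<in> I" "y \<in> I" shows "x + y \<in> I"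
proof -
  obtain m r n s where *: "x = m * r" "y = n * s" "m \<in> M" "r \<in> S" "n \<in> M" "s \<in> S"
    using assms by (auto simp: I_def)
  show ?thesis
  proof (cases "m = 0 \<or> n = 0")
    case False
    have "m / n \<in> F" using * M_R sub fld.divide by blast
    then consider "m / n \<in> R" | "n / m \<in> R" using total[of "m / n"] by auto
    then show ?thesis
    proof cases
      case 1
      then have "m / n * r + s \<in> S" using * RS by (intro S.add S.mult) auto
      moreover have "x + y = n * (m / n * r + s)" using False * by (simp add: algebra_simps)
      ultimately show ?thesis using * by (auto simp: I_def)
    next
      case 2
      then have "r + n / m * s \<in> S" using * RS by (intro S.add S.mult) auto
      moreover have "x + y = m * (r + n / m * s)" using False * by (simp add: algebra_simps)
      ultimately show ?thesis using * by (auto simp: I_def)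
    qed
  qed (use assms * in auto)
qed

lemma I_minus: "x \<in> I \<Longrightarrow> - x \<in> I"
  using I_mult[of x "- 1"] S.minus by simp

lemma I_diff: "x \<in> I \<Longrightarrow> y \<in> I \<Longrightarrow> x - y \<in> I"
  using I_add[of x "- y"] I_minus by simp

lemma I_sum: "(\<And>i. i \<in> J \<Longrightarrow> g i \<in> I) \<Longrightarrow> (\<Sum>i\<in>J. g i) \<in> I"
  by (induction J rule: infinite_finite_induct) (auto intro: I_add)

lemma one_notin_I: "1 \<notin> I"
proof
  assume "1 \<in> I"
  then obtain m r where *: "m \<in> M" "r \<in> S" "m * r = 1" by (auto simp: I_def)
  then have "r = inverse m" by (simp add: inverse_unique)
  moreover have "inverse m \<in> F" using * M_R sub fld.inverse by blast
  ultimately have "inverse m \<in> R" using * SF by auto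
  moreover have "m \<noteq> 0" using * by auto
  ultimately show False using * by (auto simp: max_ideal_def)
qed

text \<open>Maximality forces \<open>S[x]\<close> to contain an element of \<open>F\<close> outside
  \<open>R\<close>; its inverse lies in \<open>M\<close>, and scaling by it gives a polynomial over
  \<open>I\<close> with value 1.\<close>

lemma outside_witness:
  assumes "x \<in> L" "x \<notin> S"
  shows "\<exists>f. (\<forall>i. coeff f i \<in> I) \<and> poly f x = 1"
proof -
  define T where "T = (\<lambda>f. poly f x) ` S.polys"
  have "subring T"
  proof
    show "0 \<in> T" unfolding T_def by (intro image_eqI[of _ _ 0]) auto
    show "1 \<in> T" unfolding T_def by (intro image_eqI[of _ _ 1]) auto
    show "u + v \<in> T" "u * v \<in> T" if "u \<in> T" "v \<in> T" for u v
      using that S.polys_add S.polys_mult unfolding T_def by (auto simp flip: poly_add poly_mult)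
    show "- u \<in> T" if "u \<in> T" for u
      using that S.polys_minus unfolding T_def by (auto simp flip: poly_minus)
  qed
  moreover have ST: "S \<subseteq> T"
  proof
    fix s assume "s \<in> S"
    then show "s \<in> T" unfolding T_def
      by (intro image_eqI[of _ _ "[:s:]"]) (auto intro: S.polys_pCons)
  qed
  moreover have "T \<subseteq> L"
    unfolding T_def using assms SL by (auto simp: poly_altdef intro!: L.sum L.mult L.power dest: S.polysD)
  moreover have "x \<in> T" unfolding T_def
    by (intro image_eqI[of _ _ "[:0, 1:]"]) (auto intro!: S.polys_pCons)
  ultimately have "T \<inter> F \<noteq> R" using maxi[of T] assms by auto
  moreover have "R \<subseteq> T \<inter> F" using ST RS sub by auto
  ultimately obtain f where f: "f \<in> S.polys" "poly f x \<in> F" "poly f x \<notin> R"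
    unfolding T_def by auto
  define m where "m = inverse (poly f x)"
  have m: "m \<in> M" unfolding m_def using f inverse_M by blast
  have "poly f x \<noteq> 0" using f by auto
  then have "poly (smult m f) x = 1" by (simp add: m_def)
  moreover have "coeff (smult m f) i \<in> I" for i
    using m S.polysD[OF f(1)] by (auto simp: I_def)
  ultimately show ?thesis by blast
qed

text \<open>Otherwise the inverse of \<open>1 - a\<close> has a witness over \<open>I\<close>;
  clearing denominators puts a power of \<open>1 - a\<close> into \<open>I\<close>, although each
  such power is congruent to 1 modulo \<open>I\<close>.\<close>

lemma one_minus_unit:
  assumes "a \<in> I" shows "1 - a \<noteq> 0" "inverse (1 - a) \<in> S"
proof -
  show nz: "1 - a \<noteq> 0" using assms one_notin_I by auto
  show "inverse (1 - a) \<in> S"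
  proof (rule ccontr)
    assume "inverse (1 - a) \<notin> S"
    moreover have "1 - a \<in> S" using assms I_S S.diff by auto
    ultimately obtain f where f: "\<And>i. coeff f i \<in> I" "poly f (inverse (1 - a)) = 1"
      using outside_witness[of "inverse (1 - a)"] SL L.inverse by blast
    define n where "n = degree f"
    have "(1 - a) ^ n = poly f (inverse (1 - a)) * (1 - a) ^ n" using f by simp
    also have "\<dots> = (\<Sum>i\<le>n. coeff f i * (1 - a) ^ (n - i))"
      unfolding poly_altdef n_def sum_distrib_right
      using nz by (intro sum.cong) (simp_all add: mult.assoc inverse_power_mult_power)
    also have "\<dots> \<in> I"
      using \<open>1 - a \<in> S\<close> f by (intro I_sum I_mult S.power) auto
    finally have "(1 - a) ^ n \<in> I" .
    moreover have "1 - (1 - a) ^ k \<in> I" for k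
    proof (induction k)
      case (Suc k)
      have "1 - (1 - a) ^ Suc k = (1 - (1 - a) ^ k) + a * (1 - a) ^ k" by (simp add: algebra_simps)
      then show ?case using I_add[OF Suc I_mult[OF assms S.power[OF \<open>1 - a \<in> S\<close>]]] by metis
    qed auto
    ultimately have "1 - (1 - a) ^ n + (1 - a) ^ n \<in> I" using I_add by blast
    then show False using one_notin_I by simp
  qed
qed

text \<open>Since \<open>1 - coeff g 0\<close> is a unit, the relation for \<open>inverse x\<close>
  can be solved for 1; multiplied by \<open>x ^ n\<close> it expresses \<open>x ^ n\<close> by lower
  powers over \<open>S\<close>, which replace the leading term of \<open>f\<close>. The new
  coefficients stay in \<open>I\<close> because the leading one was there.\<close>

lemma reduce_degree:
  assumes x: "x \<noteq> 0"
    and f: "\<And>i. coeff f i \<in> I" "poly f x = 1"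
    and g: "\<And>i. coeff g i \<in> I" "poly g (inverse x) = 1"
    and le: "degree g \<le> degree f"
  shows "\<exists>f'. (\<forall>i. coeff f' i \<in> I) \<and> poly f' x = 1 \<and> degree f' < degree f"
proof -
  define n where "n = degree f"
  define l where "l = degree g"
  define u where "u = inverse (1 - coeff g 0)"
  have u: "u \<in> S" "1 - coeff g 0 \<noteq> 0" using one_minus_unit[OF g(1)] by (auto simp: u_def)
  have l: "l \<noteq> 0"
  proof
    assume "l = 0"
    then obtain c where "g = [:c:]" unfolding l_def by (auto elim: degree_eq_zeroE)
    with g(2) g(1)[of 0] one_notin_I show False by simp
  qed
  have n: "n \<noteq> 0" using l le by (auto simp: l_def n_def)
  define q where "q = (\<Sum>j\<in>{1..l}. monom (u * coeff g j) (n - j))"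
  have "coeff g 0 + (\<Sum>j\<in>{1..l}. coeff g j * inverse x ^ j) = 1"
    using g(2) unfolding poly_altdef l_def[symmetric]
    by (simp add: atLeast0AtMost[symmetric] sum.atLeast_Suc_atMost)
  then have "(\<Sum>j\<in>{1..l}. coeff g j * inverse x ^ j) = 1 - coeff g 0" by (simp add: algebra_simps)
  then have 1: "u * (\<Sum>j\<in>{1..l}. coeff g j * inverse x ^ j) = 1" using u(2) by (simp add: u_def)
  have "poly q x = (\<Sum>j\<in>{1..l}. u * coeff g j * x ^ (n - j))"
    by (simp add: q_def poly_sum poly_monom)
  also have "\<dots> = x ^ n * (u * (\<Sum>j\<in>{1..l}. coeff g j * inverse x ^ j))"
    unfolding sum_distrib_left
  proof (intro sum.cong refl)
    fix j assume "j \<in> {1..l}"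
    then have "x ^ (n - j) = inverse x ^ j * x ^ n"
      using x le by (simp add: inverse_power_mult_power l_def n_def)
    then show "u * coeff g j * x ^ (n - j) = x ^ n * (u * (coeff g j * inverse x ^ j))"
      by (simp only: mult_ac)
  qed
  finally have q: "poly q x = x ^ n" using 1 by simp
  have q_S: "coeff q i \<in> S" for i
    using u(1) g(1) I_S unfolding q_def coeff_sum by (auto intro!: S.sum S.mult)
  have dq: "degree q < n"
    unfolding q_def
  proof (rule le_less_trans[OF degree_sum_le])
    show "degree (monom (u * coeff g j) (n - j)) \<le> n - 1" if "j \<in> {1..l}" for j
      using that by (intro order.trans[OF degree_monom_le]) auto
  qed (use n in auto)
  define f' where "f' = f - monom (coeff f n) n + smult (coeff f n) q"
  have "poly f' x = 1" using q f(2) by (simp add: f'_def poly_monom)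
  moreover have "coeff f' i \<in> I" for i
  proof -
    have "coeff f i - coeff (monom (coeff f n) n) i \<in> I"
      using f(1) by (intro I_diff) auto
    then have "coeff f i - coeff (monom (coeff f n) n) i + coeff f n * coeff q i \<in> I"
      by (rule I_add[OF _ I_mult[OF f(1) q_S]])
    then show ?thesis by (simp only: f'_def coeff_add coeff_diff coeff_smult)
  qed
  moreover have "degree f' < n"
  proof -
    have "coeff f' n = 0" using coeff_eq_0[OF dq] by (simp add: f'_def)
    moreover have "degree f' \<le> n"
      unfolding f'_def n_def[symmetric]
      using dq by (intro degree_add_le degree_diff_le order.trans[OF degree_smult_le])
        (auto simp: n_def degree_monom_le)
    ultimately show ?thesis using n by (metis degree_0 le_neq_implies_less leading_coeff_0_iff neq0_conv)
  qed
  ultimately show ?thesis by (auto simp: n_def)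
qed

lemma valuation_ring_S: "valuation_ring L S"
proof -
  have "x \<in> S \<or> inverse x \<in> S" if x: "x \<in> L" for x
  proof (rule ccontr)
    assume *: "\<not> ?thesis"
    then have x0: "x \<noteq> 0" by auto
    define W where "W y n \<longleftrightarrow> (\<exists>f. (\<forall>i. coeff f i \<in> I) \<and> poly f y = 1 \<and> degree f = n)" for y n
    have "\<exists>n. W x n" "\<exists>n. W (inverse x) n"
      using * outside_witness[of x] outside_witness[of "inverse x"] x L.inverse by (auto simp: W_def)
    then obtain n l where
      n: "W x n" "\<And>i. i < n \<Longrightarrow> \<not> W x i" and l: "W (inverse x) l" "\<And>i. i < l \<Longrightarrow> \<not> W (inverse x) i"
      unfolding exists_least_iff[of "W x"] exists_least_iff[of "W (inverse x)"] by blast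
    obtain f g where fg: "\<And>i. coeff f i \<in> I" "poly f x = 1" "degree f = n"
      "\<And>i. coeff g i \<in> I" "poly g (inverse x) = 1" "degree g = l"
      using n(1) l(1) unfolding W_def by blast
    \<comment> \<open>Both degrees are minimal, yet the witness of larger degree can be shortened by
      means of the other.\<close>
    show False
    proof (cases "l \<le> n")
      case True
      with reduce_degree[of x f g] fg x0 obtain f' where
        "\<forall>i. coeff f' i \<in> I" "poly f' x = 1" "degree f' < n" by auto
      with n(2)[of "degree f'"] show False by (auto simp: W_def)
    next
      case False
      with reduce_degree[of "inverse x" g f] fg x0 obtain f' where
        "\<forall>i. coeff f' i \<in> I" "poly f' (inverse x) = 1" "degree f' < l" by auto
      with l(2)[of "degree f'"] show False by (auto simp: W_def)
    qed
  qed
  then show ?thesis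
    unfolding valuation_ring_def
    by (intro conjI ballI L.subfield SL S.zero S.one S.add S.mult S.minus)
qed

end

context vring
begin

theorem chevalley_extension:
  assumes "subfield L" "F \<subseteq> L"
  shows "\<exists>S. valuation_ring L S \<and> S \<inter> F = R"
proof -
  define C where "C = {T. subring T \<and> T \<subseteq> L \<and> T \<inter> F = R}"
  have RC: "R \<in> C" using assms sub subring_axioms by (auto simp: C_def)
  have chains: "\<Union>X \<in> C" if X: "X \<noteq> {}" "subset.chain C X" for X
  proof -
    have XC: "\<And>T. T \<in> X \<Longrightarrow> T \<in> C" using X by (auto simp: subset.chain_def)
    then have XS: "\<And>T. T \<in> X \<Longrightarrow> subring T" by (auto simp: C_def)
    obtain T0 where T0: "T0 \<in> X" using X by auto
    have two: "\<exists>T\<in>X. x \<in> T \<and> y \<in> T" if xy: "x \<in> \<Union>X" "y \<in> \<Union>X" for x y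
    proof -
      obtain T U where TU: "T \<in> X" "x \<in> T" "U \<in> X" "y \<in> U" using xy by blast
      then have "T \<subseteq> U \<or> U \<subseteq> T" using X(2) by (auto simp: subset_chain_def)
      then show ?thesis using TU by blast
    qed
    have "subring (\<Union>X)"
    proof
      show "0 \<in> \<Union>X" "1 \<in> \<Union>X"
        using T0 subring.zero[OF XS[OF T0]] subring.one[OF XS[OF T0]] by blast+
      show "x + y \<in> \<Union>X" "x * y \<in> \<Union>X" if xy: "x \<in> \<Union>X" "y \<in> \<Union>X" for x y
      proof -
        obtain T where T: "T \<in> X" "x \<in> T" "y \<in> T" using two[OF xy] by blast
        then show "x + y \<in> \<Union>X" "x * y \<in> \<Union>X"
          using subring.add[OF XS[OF T(1)]] subring.mult[OF XS[OF T(1)]] by blast+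
      qed
      show "- x \<in> \<Union>X" if x: "x \<in> \<Union>X" for x
      proof -
        obtain T where T: "T \<in> X" "x \<in> T" using x by blast
        then show ?thesis using subring.minus[OF XS[OF T(1)]] by blast
      qed
    qed
    then show ?thesis using XC T0 by (auto simp: C_def)
  qed
  have "\<exists>S\<in>C. \<forall>T\<in>C. S \<subseteq> T \<longrightarrow> T = S"
    by (rule subset_Zorn_nonempty) (use RC chains in auto)
  then obtain S where S: "S \<in> C" "\<And>T. T \<in> C \<Longrightarrow> S \<subseteq> T \<Longrightarrow> T = S" by blast
  interpret maximal_over F R L S
  proof
    show "subfield L" "F \<subseteq> L" by fact+
    have "subring S" using S(1) by (simp add: C_def)
    then show "0 \<in> S" "1 \<in> S" "\<And>x y. x \<in> S \<Longrightarrow> y \<in> S \<Longrightarrow> x + y \<in> S"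
      "\<And>x y. x \<in> S \<Longrightarrow> y \<in> S \<Longrightarrow> x * y \<in> S" "\<And>x. x \<in> S \<Longrightarrow> - x \<in> S"
      by (simp_all add: subring_def)
    show "S \<subseteq> L" "S \<inter> F = R" using S(1) by (simp_all add: C_def)
    show "T = S" if "subring T" "S \<subseteq> T" "T \<subseteq> L" "T \<inter> F = R" for T
      using S(2)[of T] that by (simp add: C_def)
  qed
  show ?thesis by (rule exI[of _ S]) (simp add: valuation_ring_S SF)
qed

end

section \<open>Kummer extensions of prime degree\<close>

lemma adjoin_subfield: "subfield (adjoin K S)"
  unfolding adjoin_def subfield_def by auto

lemma adjoin_base: "K \<subseteq> adjoin K S" and adjoin_gens: "S \<subseteq> adjoin K S"
  unfolding adjoin_def by auto

lemma adjoin_least: "subfield F \<Longrightarrow> K \<subseteq> F \<Longrightarrow> S \<subseteq> F \<Longrightarrow> adjoin K S \<subseteq> F"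
  unfolding adjoin_def by auto

locale field_pair = K: subfield_set K + L: subfield_set L
  for K L :: "'a::field_char_0 set" +
  assumes KL: "K \<subseteq> L"
begin

lemma gal_in: "\<tau> \<in> gal K L \<Longrightarrow> x \<in> L \<Longrightarrow> \<tau> x \<in> L"
  by (auto simp: gal_def bij_betw_def)

lemma gal_add: "\<tau> \<in> gal K L \<Longrightarrow> x \<in> L \<Longrightarrow> y \<in> L \<Longrightarrow> \<tau> (x + y) = \<tau> x + \<tau> y"
  and gal_mult: "\<tau> \<in> gal K L \<Longrightarrow> x \<in> L \<Longrightarrow> y \<in> L \<Longrightarrow> \<tau> (x * y) = \<tau> x * \<tau> y"
  and gal_K: "\<tau> \<in> gal K L \<Longrightarrow> x \<in> K \<Longrightarrow> \<tau> x = x"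
  by (auto simp: gal_def)

lemma gal_outside: "\<tau> \<in> gal K L \<Longrightarrow> x \<notin> L \<Longrightarrow> \<tau> x = x"
  by (auto simp: gal_def)

lemma gal_minus: assumes "\<tau> \<in> gal K L" "x \<in> L" shows "\<tau> (- x) = - \<tau> x"
  using gal_mult[OF assms(1), of "- 1" x] gal_K[OF assms(1), of "- 1"] assms L.minus K.minus by simp

lemma gal_diff: "\<tau> \<in> gal K L \<Longrightarrow> x \<in> L \<Longrightarrow> y \<in> L \<Longrightarrow> \<tau> (x - y) = \<tau> x - \<tau> y"
  using gal_add[of \<tau> x "- y"] gal_minus[of \<tau> y] L.minus by simp

lemma gal_eq_0: assumes "\<tau> \<in> gal K L" "x \<in> L" shows "\<tau> x = 0 \<longleftrightarrow> x = 0"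
proof -
  have "inj_on \<tau> L" "\<tau> 0 = 0" using assms by (auto simp: gal_def bij_betw_def)
  then show ?thesis using assms by (metis L.zero inj_onD)
qed

lemma gal_inverse: assumes "\<tau> \<in> gal K L" "x \<in> L" shows "\<tau> (inverse x) = inverse (\<tau> x)"
proof (cases "x = 0")
  case True
  then show ?thesis using gal_K[OF assms(1), of 0] by simp
next
  case False
  then have "\<tau> x * \<tau> (inverse x) = 1"
    using gal_mult[OF assms, of "inverse x"] gal_K[OF assms(1), of 1] assms L.inverse by simp
  then show ?thesis by (simp add: inverse_unique)
qed

lemma gal_divide: "\<tau> \<in> gal K L \<Longrightarrow> x \<in> L \<Longrightarrow> y \<in> L \<Longrightarrow> \<tau> (x / y) = \<tau> x / \<tau> y"
  by (simp add: divide_inverse gal_mult gal_inverse L.inverse)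

lemma gal_sum: "\<tau> \<in> gal K L \<Longrightarrow> (\<And>i. i \<in> I \<Longrightarrow> g i \<in> L) \<Longrightarrow> \<tau> (\<Sum>i\<in>I. g i) = (\<Sum>i\<in>I. \<tau> (g i))"
  by (induction I rule: infinite_finite_induct) (auto simp: gal_add gal_K L.sum)

lemma gal_prod: "\<tau> \<in> gal K L \<Longrightarrow> (\<And>i. i \<in> I \<Longrightarrow> g i \<in> L) \<Longrightarrow> \<tau> (\<Prod>i\<in>I. g i) = (\<Prod>i\<in>I. \<tau> (g i))"
  by (induction I rule: infinite_finite_induct) (auto simp: gal_mult gal_K L.prod)

lemma gal_power: "\<tau> \<in> gal K L \<Longrightarrow> x \<in> L \<Longrightarrow> \<tau> (x ^ n) = \<tau> x ^ n"
  by (induction n) (auto simp: gal_mult gal_K L.power)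

lemma gal_poly: "\<tau> \<in> gal K L \<Longrightarrow> f \<in> K.polys \<Longrightarrow> x \<in> L \<Longrightarrow> \<tau> (poly f x) = poly f (\<tau> x)"
  unfolding poly_altdef using KL
  by (auto simp: gal_sum gal_mult gal_power gal_K K.polysD L.mult L.power subsetD)

lemma gal_compose:
  assumes "\<tau> \<in> gal K L" "\<rho> \<in> gal K L" shows "\<tau> \<circ> \<rho> \<in> gal K L"
proof -
  have "bij_betw \<rho> L L" "bij_betw \<tau> L L" using assms by (simp_all add: gal_def)
  then have "bij_betw (\<tau> \<circ> \<rho>) L L" by (rule bij_betw_trans)
  moreover have "\<tau> (\<rho> x) = x" if "x \<notin> L" for x
    using that by (simp add: gal_outside[OF assms(1)] gal_outside[OF assms(2)])
  ultimately show ?thesis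
    using assms gal_in[OF assms(2)]
    by (auto simp: gal_def[of K L] gal_add[OF assms(1)] gal_add[OF assms(2)]
        gal_mult[OF assms(1)] gal_mult[OF assms(2)] gal_K[OF assms(1)] gal_K[OF assms(2)])
qed

lemma gal_id: "id \<in> gal K L"
  by (auto simp: gal_def)

lemma gal_funpow: "\<tau> \<in> gal K L \<Longrightarrow> \<tau> ^^ n \<in> gal K L"
proof (induction n)
  case 0
  then show ?case using gal_id by (simp add: id_def)
next
  case (Suc n)
  then show ?case using gal_compose[of \<tau> "\<tau> ^^ n"] by (simp add: comp_def)
qed

lemma gal_coeff_prod_linear:
  assumes "\<tau> \<in> gal K L" "finite J" "\<And>j. j \<in> J \<Longrightarrow> r j \<in> L"
  shows "\<tau> (coeff (\<Prod>j\<in>J. [:- r j, 1:]) k) = coeff (\<Prod>j\<in>J. [:- \<tau> (r j), 1:]) k"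
  using assms(2,3)
proof (induction J arbitrary: k)
  case empty
  show ?case using gal_K[OF assms(1)] by (cases k) auto
next
  case (insert i J)
  have L: "coeff (\<Prod>j\<in>J. [:- r j, 1:]) k \<in> L" for k
    using insert.prems by (auto intro!: L.polysD L.polys_prod L.polys_pCons L.minus)
  show ?case
    using insert L assms(1) gal_K[OF assms(1), of 0]
    by (auto simp: coeff_pCons gal_add gal_minus gal_mult gal_diff L.mult L.minus split: nat.splits)
qed

end

locale kummer = K: subfield_set K for K :: "'a::field_char_0 set" +
  fixes L :: "'a set" and p :: nat and \<zeta> \<alpha> h :: 'a and \<sigma> :: "'a \<Rightarrow> 'a"
  assumes p: "prime p" and \<zeta>K: "\<zeta> \<in> K" and \<zeta>p: "\<zeta> ^ p = 1"
    and \<zeta>_prim: "\<And>k. 0 < k \<Longrightarrow> k < p \<Longrightarrow> \<zeta> ^ k \<noteq> 1"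
    and hK: "h \<in> K" and h0: "h \<noteq> 0" and \<alpha>p: "\<alpha> ^ p = h" and \<alpha>K: "\<alpha> \<notin> K"
    and L_def: "L = adjoin K {\<alpha>}" and \<sigma>: "\<sigma> \<in> gal K L" and \<sigma>\<alpha>: "\<sigma> \<alpha> = \<zeta> * \<alpha>"
begin

sublocale field_pair K L
proof
  show "subfield L" unfolding L_def by (rule adjoin_subfield)
  show "K \<subseteq> L" unfolding L_def by (rule adjoin_base)
qed

lemma \<alpha>L: "\<alpha> \<in> L" unfolding L_def using adjoin_gens by blast

lemma p_gt: "1 < p" "0 < p" using p prime_gt_1_nat prime_gt_0_nat by auto

lemma \<alpha>0: "\<alpha> \<noteq> 0" using \<alpha>K by auto

lemma \<zeta>_power_eq_1: "\<zeta> ^ k = 1 \<longleftrightarrow> p dvd k"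
proof
  have "\<zeta> ^ k = \<zeta> ^ (p * (k div p) + k mod p)" by simp
  also have "\<dots> = \<zeta> ^ (k mod p)" unfolding power_add power_mult \<zeta>p by simp
  finally have *: "\<zeta> ^ k = \<zeta> ^ (k mod p)" .
  show "p dvd k" if "\<zeta> ^ k = 1"
    using * that \<zeta>_prim[of "k mod p"] p_gt by (metis dvd_eq_mod_eq_0 mod_less_divisor not_gr_zero)
  show "\<zeta> ^ k = 1" if "p dvd k" using * that by simp
qed

lemma primitive_power_inj:
  fixes \<omega> :: 'a
  assumes "\<omega> ^ p = 1" "\<omega> \<noteq> 1"
  shows "inj_on (\<lambda>i. \<omega> ^ i) {..<p}"
proof (rule linorder_inj_onI)
  fix i j assume ij: "i < j" "i \<in> {..<p}" "j \<in> {..<p}"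
  have \<omega>0: "\<omega> \<noteq> 0" using assms p_gt by (metis not_gr_zero power_0_left zero_neq_one less_irrefl)
  show "\<omega> ^ i \<noteq> \<omega> ^ j"
  proof
    assume "\<omega> ^ i = \<omega> ^ j"
    then have 1: "\<omega> ^ (j - i) = 1" using ij \<omega>0 by (simp add: power_diff)
    have "\<not> p dvd j - i" using ij by (auto dest: dvd_imp_le)
    then obtain x y where "(j - i) * x = Suc (p * y)" using bezout_prime[OF p] by blast
    then have "\<omega> ^ ((j - i) * x) = \<omega> ^ (p * y) * \<omega>" by (simp add: mult.commute)
    then show False unfolding power_mult 1 assms(1) using assms(2) by simp
  qed
qed auto

lemma root_of_unity:
  assumes "x ^ p = 1" shows "\<exists>i<p. x = \<zeta> ^ i"
proof (rule ccontr)
  assume *: "\<not> ?thesis"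
  have inj: "inj_on (\<lambda>i. \<zeta> ^ i) {..<p}"
    using primitive_power_inj[OF \<zeta>p] \<zeta>_prim[of 1] p_gt by auto
  define P where "P = monom 1 p - (1 :: 'a poly)"
  have "coeff P p = 1" using p_gt by (simp add: P_def)
  then have P0: "P \<noteq> 0" by auto
  have "degree P \<le> p" unfolding P_def by (intro degree_diff_le) (auto simp: degree_monom_le)
  moreover have "card (insert x ((\<lambda>i. \<zeta> ^ i) ` {..<p})) = Suc p"
    using inj * by (subst card_insert_disjoint) (auto simp: card_image)
  moreover have "insert x ((\<lambda>i. \<zeta> ^ i) ` {..<p}) \<subseteq> {x. poly P x = 0}"
    using assms \<zeta>p by (auto simp: P_def poly_monom simp flip: power_mult)
      (metis mult.commute power_mult power_one)
  then have "card (insert x ((\<lambda>i. \<zeta> ^ i) ` {..<p})) \<le> card {x. poly P x = 0}"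
    by (intro card_mono poly_roots_finite P0)
  ultimately show False using card_poly_roots_bound[OF P0] by linarith
qed

abbreviation s where "s i \<equiv> \<sigma> ^^ i"

lemma s_gal: "s i \<in> gal K L" by (rule gal_funpow[OF \<sigma>])

lemma s_\<alpha>: "s i \<alpha> = \<zeta> ^ i * \<alpha>"
proof (induction i)
  case (Suc i)
  have "\<zeta> ^ i \<in> K" by (intro K.power \<zeta>K)
  then show ?case
    using Suc \<alpha>L KL by (simp add: gal_mult[OF \<sigma>] gal_K[OF \<sigma>] \<sigma>\<alpha> subsetD)
qed auto

lemma poly_\<alpha>_reduce:
  "f \<in> K.polys \<Longrightarrow> \<exists>g\<in>K.polys. degree g < p \<and> poly f \<alpha> = poly g \<alpha>"
proof (induction f)
  case 0
  then show ?case using p_gt by (intro bexI[of _ 0]) auto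
next
  case (pCons a f)
  have "a \<in> K" using K.polysD[OF pCons.prems, of 0] by simp
  moreover have "f \<in> K.polys"
    using K.polysD[OF pCons.prems, of "Suc _"] by (intro K.polysI) simp
  ultimately obtain g where g: "a \<in> K" "g \<in> K.polys" "degree g < p" "poly f \<alpha> = poly g \<alpha>"
    using pCons.IH by blast
  define q where "q = pCons a g - smult (coeff g (p - 1)) (monom 1 p - [:h:])"
  have "degree q < p"
  proof -
    have "degree (pCons a g) \<le> p" using g(3) by (simp add: degree_pCons_eq_if)
    moreover have "degree (monom 1 p - [:h:]) \<le> p"
      by (intro degree_diff_le) (auto simp: degree_monom_le)
    ultimately have "degree q \<le> p"
      unfolding q_def by (rule degree_diff_le[OF _ order.trans[OF degree_smult_le]])
    moreover have "coeff q p = 0" using p_gt by (cases p) (auto simp: q_def)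
    ultimately show ?thesis using p_gt by (metis degree_0 le_neq_implies_less leading_coeff_0_iff)
  qed
  moreover have "q \<in> K.polys"
    unfolding q_def using g hK
    by (intro K.polys_diff K.polys_pCons K.polys_smult K.polys_monom) (auto simp: K.polysD)
  moreover have "poly (pCons a f) \<alpha> = poly q \<alpha>"
    using g by (simp add: q_def poly_monom \<alpha>p)
  ultimately show ?case by blast
qed

text \<open>Average over the powers of \<sigma>: for 0 < i < p the powers of \<zeta> ^ i sum to 0,
  so only the constant coefficient survives.\<close>

lemma fixed_poly_in_K:
  assumes f: "f \<in> K.polys" and fixd: "\<sigma> (poly f \<alpha>) = poly f \<alpha>"
  shows "poly f \<alpha> \<in> K"
proof -
  obtain g where g: "g \<in> K.polys" "degree g < p" "poly f \<alpha> = poly g \<alpha>"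
    using poly_\<alpha>_reduce[OF f] by blast
  define x where "x = poly f \<alpha>"
  have "s j x = x" for j
    using fixd by (induction j) (auto simp: x_def)
  then have "of_nat p * x = (\<Sum>j<p. s j x)" by simp
  also have "\<dots> = (\<Sum>j<p. poly g (\<zeta> ^ j * \<alpha>))"
    using g(1,3) \<alpha>L by (simp add: x_def gal_poly[OF s_gal] s_\<alpha>)
  also have "\<dots> = (\<Sum>j<p. \<Sum>i\<le>degree g. coeff g i * (\<zeta> ^ j * \<alpha>) ^ i)"
    by (simp only: poly_altdef)
  also have "\<dots> = (\<Sum>i\<le>degree g. coeff g i * \<alpha> ^ i * (\<Sum>j<p. (\<zeta> ^ i) ^ j))"
    by (subst sum.swap) (simp add: sum_distrib_left power_mult_distrib mult_ac flip: power_mult)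
  also have "\<dots> = (\<Sum>i\<le>degree g. if i = 0 then coeff g 0 * of_nat p else 0)"
  proof (intro sum.cong refl)
    fix i assume i: "i \<in> {..degree g}"
    have "(\<Sum>j<p. (\<zeta> ^ i) ^ j) = 0" if "i \<noteq> 0"
    proof -
      have "\<zeta> ^ i \<noteq> 1" using \<zeta>_prim i that g(2) by auto
      moreover have "(\<zeta> ^ i) ^ p = 1" by (metis \<zeta>p mult.commute power_mult power_one)
      ultimately show ?thesis by (simp add: geometric_sum)
    qed
    then show "coeff g i * \<alpha> ^ i * (\<Sum>j<p. (\<zeta> ^ i) ^ j) = (if i = 0 then coeff g 0 * of_nat p else 0)"
      by auto
  qed
  also have "\<dots> = of_nat p * coeff g 0" by simp
  finally have "x = coeff g 0" using p_gt by simp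
  then show ?thesis using K.polysD[OF g(1)] by (simp add: x_def)
qed

text \<open>Applying \<sigma> permutes an orbit cyclically. \<open>G\<close> is the identity for
  norms and a linear factor for characteristic polynomials. The hypothesis concerns a single
  \<open>x\<close> because one use precedes the proof that \<sigma> has order p on L.\<close>

lemma prod_s_shift:
  assumes "(\<sigma> ^^ p) x = x"
  shows "(\<Prod>j<p. G (s (Suc j) x)) = (\<Prod>j<p. G (s j x))"
proof -
  obtain q where q: "p = Suc q" using p_gt by (cases p) auto
  have "(\<Prod>j<p. G (s j x)) = G x * (\<Prod>j<q. G (s (Suc j) x))"
    unfolding q by (subst prod.lessThan_Suc_shift) simp
  also have "\<dots> = (\<Prod>j<p. G (s (Suc j) x))"
    using assms unfolding q by (simp add: mult.commute)
  finally show ?thesis by simp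
qed

lemma L_eq_polys: "L = (\<lambda>f. poly f \<alpha>) ` K.polys"
proof
  define P where "P = (\<lambda>f. poly f \<alpha>) ` K.polys"
  show PL: "(\<lambda>f. poly f \<alpha>) ` K.polys \<subseteq> L"
    using KL \<alpha>L by (auto simp: poly_altdef intro!: L.sum L.mult L.power dest: K.polysD)
  interpret P: subring P
  proof
    show "0 \<in> P" unfolding P_def by (intro image_eqI[of _ _ 0]) auto
    show "1 \<in> P" unfolding P_def by (intro image_eqI[of _ _ 1]) auto
    show "u + v \<in> P" "u * v \<in> P" if "u \<in> P" "v \<in> P" for u v
      using that K.polys_add K.polys_mult unfolding P_def by (auto simp flip: poly_add poly_mult)
    show "- u \<in> P" if "u \<in> P" for u
      using that K.polys_minus unfolding P_def by (auto simp flip: poly_minus)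
  qed
  have s_P: "s i x \<in> P" if "x \<in> P" for i x
  proof -
    obtain f where f: "f \<in> K.polys" "x = poly f \<alpha>" using \<open>x \<in> P\<close> by (auto simp: P_def)
    have "s i x = poly (pcompose f [:0, \<zeta> ^ i:]) \<alpha>"
      using f \<alpha>L by (simp add: gal_poly[OF s_gal] s_\<alpha> poly_pcompose mult.commute)
    moreover have "pcompose f [:0, \<zeta> ^ i:] \<in> K.polys"
      using f \<zeta>K by (intro K.polys_pcompose K.polys_pCons K.power) auto
    ultimately show ?thesis unfolding P_def by blast
  qed
  have KP: "K \<subseteq> P"
  proof
    fix c assume "c \<in> K"
    then show "c \<in> P" unfolding P_def
      by (intro image_eqI[of _ _ "[:c:]"]) (auto intro!: K.polys_pCons)
  qed
  have "inverse x \<in> P" if x: "x \<in> P" for x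
  proof (cases "x = 0")
    case False
    have xL: "x \<in> L" using x PL by (auto simp: P_def)
    have sp: "s p x = x"
      using x \<alpha>L \<zeta>p unfolding P_def by (auto simp: gal_poly[OF s_gal] s_\<alpha>)
    \<comment> \<open>The inverse of \<open>x\<close> is the product \<open>y\<close> of its other
      conjugates divided by the norm, and the norm lies in K because \<sigma> fixes it.\<close>
    define N where "N = (\<Prod>j<p. s j x)"
    have NP: "N \<in> P" unfolding N_def using x s_P by (intro P.prod) auto
    have "\<sigma> N = (\<Prod>j<p. s (Suc j) x)"
      unfolding N_def using xL by (subst gal_prod[OF \<sigma>]) (auto intro: gal_in[OF s_gal])
    also have "\<dots> = N" unfolding N_def by (rule prod_s_shift[OF sp])
    finally have NK: "N \<in> K" using NP fixed_poly_in_K by (auto simp: P_def)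
    have N0: "N \<noteq> 0" unfolding N_def using xL False gal_eq_0[OF s_gal] by auto
    define y where "y = (\<Prod>j\<in>{1..<p}. s j x)"
    have "y \<in> P" unfolding y_def using x s_P by (intro P.prod) auto
    moreover have "{..<p} = insert 0 {1..<p}" using p_gt by auto
    then have "N = x * y" unfolding N_def y_def by simp
    then have "inverse x = y * inverse N" using N0 by simp
    ultimately show ?thesis using P.mult[of y "inverse N"] NK K.inverse KP by auto
  qed auto
  then have "subfield P"
    unfolding subfield_def using P.add P.mult P.minus by auto
  moreover have "\<alpha> \<in> P" unfolding P_def
    by (intro image_eqI[of _ _ "[:0, 1:]"]) (auto intro!: K.polys_pCons)
  ultimately show "L \<subseteq> (\<lambda>f. poly f \<alpha>) ` K.polys"
    unfolding L_def P_def[symmetric] using KP by (intro adjoin_least) auto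
qed

lemma L_poly_rep: "x \<in> L \<Longrightarrow> \<exists>f\<in>K.polys. degree f < p \<and> x = poly f \<alpha>"
  using poly_\<alpha>_reduce by (auto simp: L_eq_polys)

lemma fixed_in_K: "x \<in> L \<Longrightarrow> \<sigma> x = x \<Longrightarrow> x \<in> K"
  using fixed_poly_in_K by (auto simp: L_eq_polys)

lemma gal_eqI:
  assumes "\<tau> \<in> gal K L" "\<rho> \<in> gal K L" "\<tau> \<alpha> = \<rho> \<alpha>" shows "\<tau> = \<rho>"
proof
  fix x show "\<tau> x = \<rho> x"
  proof (cases "x \<in> L")
    case True
    then obtain f where "f \<in> K.polys" "x = poly f \<alpha>" by (auto simp: L_eq_polys)
    then show ?thesis using assms \<alpha>L by (simp add: gal_poly[OF assms(1)] gal_poly[OF assms(2)])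
  qed (simp add: gal_outside[OF assms(1)] gal_outside[OF assms(2)])
qed

lemma s_p: "s p = id"
  by (rule gal_eqI[OF s_gal gal_id]) (simp add: s_\<alpha> \<zeta>p)

lemma s_mod: "s (p * k + j) = s j"
proof -
  have "s (p * k) = (s p) ^^ k" by (simp add: funpow_mult)
  also have "\<dots> = id" by (simp add: s_p)
  finally show ?thesis by (simp add: funpow_add)
qed

lemma gal_eq: "gal K L = s ` {..<p}"
proof
  show "gal K L \<subseteq> s ` {..<p}"
  proof
    fix \<tau> assume \<tau>: "\<tau> \<in> gal K L"
    have "(\<tau> \<alpha>) ^ p = h"
      using gal_power[OF \<tau> \<alpha>L] gal_K[OF \<tau> hK] \<alpha>p by metis
    then have "(\<tau> \<alpha> / \<alpha>) ^ p = 1" using \<alpha>p h0 by (simp add: power_divide)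
    then obtain i where "i < p" "\<tau> \<alpha> / \<alpha> = \<zeta> ^ i" using root_of_unity by blast
    then have "\<tau> \<alpha> = s i \<alpha>" using \<alpha>0 by (simp add: s_\<alpha> field_simps)
    then have "\<tau> = s i" using gal_eqI[OF \<tau> s_gal] by blast
    then show "\<tau> \<in> s ` {..<p}" using \<open>i < p\<close> by blast
  qed
qed (use s_gal in auto)

lemma s_inj: "inj_on s {..<p}"
proof (rule inj_onI)
  fix i j assume ij: "i \<in> {..<p}" "j \<in> {..<p}" and "s i = s j"
  then have "s i \<alpha> = s j \<alpha>" by simp
  then have "\<zeta> ^ i = \<zeta> ^ j" using \<alpha>0 by (simp add: s_\<alpha>)
  then show "i = j" using primitive_power_inj[OF \<zeta>p] \<zeta>_prim[of 1] p_gt ij by (auto dest: inj_onD)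
qed

section \<open>Norms and characteristic polynomials\<close>

abbreviation N where "N \<equiv> field_norm K L"

lemma norm_eq: "N x = (\<Prod>j<p. s j x)"
  unfolding field_norm_def gal_eq by (subst prod.reindex[OF s_inj]) simp

lemma norm_K: assumes "x \<in> L" shows "N x \<in> K"
proof (rule fixed_in_K)
  show "N x \<in> L" unfolding norm_eq using assms gal_in[OF s_gal] by (auto intro: L.prod)
  have "\<sigma> (N x) = (\<Prod>j<p. s (Suc j) x)"
    unfolding norm_eq using assms by (subst gal_prod[OF \<sigma>]) (auto intro: gal_in[OF s_gal])
  also have "\<dots> = N x" unfolding norm_eq by (rule prod_s_shift) (simp add: s_p)
  finally show "\<sigma> (N x) = N x" .
qed

lemma norm_mult: "x \<in> L \<Longrightarrow> y \<in> L \<Longrightarrow> N (x * y) = N x * N y"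
  by (simp add: norm_eq gal_mult[OF s_gal] prod.distrib)

lemma norm_divide: "x \<in> L \<Longrightarrow> y \<in> L \<Longrightarrow> N (x / y) = N x / N y"
  by (simp add: norm_eq gal_divide[OF s_gal] prod_dividef)

lemma norm_of_K: "c \<in> K \<Longrightarrow> N c = c ^ p"
  by (simp add: norm_eq gal_K[OF s_gal])

lemma norm_eq_0: "x \<in> L \<Longrightarrow> N x = 0 \<longleftrightarrow> x = 0"
  using gal_eq_0[OF s_gal] p_gt by (auto simp: norm_eq)

lemma norm_\<sigma>: assumes "x \<in> L" shows "N (\<sigma> x) = N x"
proof -
  have "N (\<sigma> x) = (\<Prod>j<p. s (Suc j) x)" unfolding norm_eq by (simp add: funpow_swap1)
  also have "\<dots> = N x" unfolding norm_eq by (rule prod_s_shift) (simp add: s_p)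
  finally show ?thesis .
qed

text \<open>The product runs over all p powers of \<sigma>, so the degree is p even for
  \<open>x \<in> K\<close>.\<close>

definition charpoly where "charpoly x = (\<Prod>j<p. [:- s j x, 1:])"

lemma charpoly_K: assumes "x \<in> L" shows "charpoly x \<in> K.polys"
proof (rule K.polysI, rule fixed_in_K)
  fix i
  have "charpoly x \<in> L.polys"
    unfolding charpoly_def using assms gal_in[OF s_gal]
    by (intro L.polys_prod L.polys_pCons L.minus) auto
  then show "coeff (charpoly x) i \<in> L" by (rule L.polysD)
  have "\<sigma> (coeff (charpoly x) i) = coeff (\<Prod>j<p. [:- s (Suc j) x, 1:]) i"
    unfolding charpoly_def using assms gal_in[OF s_gal]
    by (subst gal_coeff_prod_linear[OF \<sigma>]) auto
  also have "(\<Prod>j<p. [:- s (Suc j) x, 1:]) = charpoly x"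
    unfolding charpoly_def by (rule prod_s_shift) (simp add: s_p)
  finally show "\<sigma> (coeff (charpoly x) i) = coeff (charpoly x) i" .
qed

lemma charpoly_monic: "lead_coeff (charpoly x) = 1"
  by (simp add: charpoly_def lead_coeff_prod)

lemma poly_charpoly: "poly (charpoly x) y = (\<Prod>j<p. y - s j x)"
  by (simp add: charpoly_def poly_prod)

lemma charpoly_root: "poly (charpoly x) x = 0"
  unfolding poly_charpoly using p_gt by (intro prod_zero) (auto intro!: bexI[of _ 0])

text \<open>As polynomials in \<open>c\<close>, both sides are monic of degree p and agree at the p
  points \<omega> ^ j * \<beta>. These are distinct only if \<beta> is nonzero, so \<beta> = 0 is
  treated apart.\<close>

lemma prod_minus_roots:
  fixes \<omega> :: 'a
  assumes "\<omega> ^ p = 1" "\<omega> \<noteq> 1"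
  shows "(\<Prod>j<p. c - \<omega> ^ j * \<beta>) = c ^ p - \<beta> ^ p"
proof (cases "\<beta> = 0")
  case False
  define P where "P = (\<Prod>j<p. [:- (\<omega> ^ j * \<beta>), 1:])"
  define Q where "Q = monom 1 p - [:\<beta> ^ p:]"
  have dP: "degree P = p" by (simp add: P_def degree_prod_eq_sum_degree)
  have "P = Q"
  proof (rule poly_eqI_degree_lead_coeff[where n = p and A = "(\<lambda>j. \<omega> ^ j * \<beta>) ` {..<p}"])
    have "lead_coeff P = 1" by (simp add: P_def lead_coeff_prod)
    then show "coeff P p = coeff Q p" using p_gt dP by (simp add: Q_def coeff_pCons split: nat.splits)
    have "inj_on (\<lambda>j. \<omega> ^ j * \<beta>) {..<p}"
      using primitive_power_inj[OF assms] False by (auto simp: inj_on_def)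
    then show "p \<le> card ((\<lambda>j. \<omega> ^ j * \<beta>) ` {..<p})" by (simp add: card_image)
    show "degree P \<le> p" "degree Q \<le> p"
      using dP unfolding Q_def by (auto intro!: degree_diff_le simp: degree_monom_le)
    fix z assume "z \<in> (\<lambda>j. \<omega> ^ j * \<beta>) ` {..<p}"
    then obtain j where j: "j < p" "z = \<omega> ^ j * \<beta>" by auto
    have "poly P z = 0"
      unfolding P_def poly_prod using j by (intro prod_zero) auto
    moreover have "z ^ p = \<beta> ^ p"
      using j assms(1) by (simp add: power_mult_distrib) (metis mult.commute power_mult power_one mult_1)
    ultimately show "poly P z = poly Q z" by (simp add: Q_def poly_monom)
  qed
  then have "poly P c = poly Q c" by simp
  then show ?thesis by (simp add: P_def Q_def poly_prod poly_monom)
qed (use p_gt in \<open>auto simp: power_0_left\<close>)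

lemma s_\<beta>:
  assumes "\<beta> \<in> L" "\<omega> \<in> K" "\<sigma> \<beta> = \<omega> * \<beta>" shows "s j \<beta> = \<omega> ^ j * \<beta>"
proof (induction j)
  case (Suc i)
  have "\<omega> ^ i \<in> K" using assms by (intro K.power)
  then show ?case
    using Suc assms KL by (simp add: gal_mult[OF \<sigma>] gal_K[OF \<sigma>] subsetD)
qed auto

text \<open>As \<sigma> fixes \<open>c\<close>, the element is (\<omega> - 1) \<beta> / (\<beta> -
  c). The norm of \<beta> - d is used for d = c and for d = 0, and the signs (-1)^p cancel in the
  quotient, for odd and even p alike.\<close>

lemma norm_quotient:
  assumes "\<beta> \<in> L" "\<omega> \<in> K" "\<sigma> \<beta> = \<omega> * \<beta>" "\<omega> ^ p = 1" "\<omega> \<noteq> 1" "c \<in> K" "\<beta> \<noteq> c"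
  shows "N (\<sigma> (\<beta> - c) / (\<beta> - c) - 1) = (\<omega> - 1) ^ p * (\<beta> ^ p / (\<beta> ^ p - c ^ p))"
proof -
  have cL: "c \<in> L" using assms KL by auto
  have nz: "\<beta> - c \<noteq> 0" using assms by auto
  have "\<sigma> (\<beta> - c) / (\<beta> - c) - 1 = (\<omega> - 1) * \<beta> / (\<beta> - c)"
    using assms cL nz by (simp add: gal_diff[OF \<sigma>] gal_K[OF \<sigma>] divide_simps) (simp add: algebra_simps)
  moreover have "N (\<beta> - d) = (- 1) ^ p * (d ^ p - \<beta> ^ p)" if "d \<in> K" for d
  proof -
    have "N (\<beta> - d) = (\<Prod>j<p. (- 1) * (d - \<omega> ^ j * \<beta>))"
      unfolding norm_eq using assms that KL
      by (intro prod.cong) (auto simp: gal_diff[OF s_gal] gal_K[OF s_gal] s_\<beta>)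
    also have "\<dots> = (- 1) ^ p * (\<Prod>j<p. d - \<omega> ^ j * \<beta>)" by (subst prod.distrib) simp
    finally show ?thesis using prod_minus_roots[OF assms(4,5)] by simp
  qed
  from this[OF assms(6)] this[OF K.zero]
  have "N (\<beta> - c) = (- 1) ^ p * (c ^ p - \<beta> ^ p)" "N \<beta> = (- 1) ^ p * (- (\<beta> ^ p))"
    using p_gt by (auto simp: power_0_left)
  moreover have "N ((\<omega> - 1) * \<beta> / (\<beta> - c)) = N (\<omega> - 1) * N \<beta> / N (\<beta> - c)"
  proof -
    have "\<omega> - 1 \<in> L" using assms KL by (intro L.diff) auto
    then show ?thesis
      using norm_mult[of "\<omega> - 1" \<beta>] norm_divide[of "(\<omega> - 1) * \<beta>" "\<beta> - c"] assms cL
      by (simp add: L.mult L.diff)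
  qed
  moreover have "N (\<omega> - 1) = (\<omega> - 1) ^ p"
    using assms by (intro norm_of_K K.diff) auto
  moreover have "c ^ p - \<beta> ^ p = - (\<beta> ^ p - c ^ p)" by simp
  moreover have "a * (e * - b) / (e * - d) = a * (b / d)" if "e \<noteq> 0" for a b d e :: 'a
    using that by simp
  from this[of "(- 1) ^ p"] have "a * ((- 1) ^ p * - b) / ((- 1) ^ p * - d) = a * (b / d)"
    for a b d :: 'a by simp
  ultimately show ?thesis by (simp only:)
qed

end

section \<open>The valuation ring of the extension\<close>

locale kummer_val = kummer + A: vring K A for A +
  fixes B
  assumes hens: "henselian A" and pM: "of_nat p \<in> max_ideal A" and B_def: "B = int_closure A L"
begin

text \<open>If \<open>w\<close> lies outside \<open>R\<close>, then \<open>w ^ (n - 1) / (1 + w + \<dots> + w ^ (n - 1))\<close> is congruent to \<open>1\<close>;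
  if it lies inside, a suitable prime \<open>n\<close> makes the denominator a unit.\<close>

lemma approximation:
  assumes R: "valuation_ring L R" and z: "z \<in> L"
  shows "\<exists>c\<in>L. (\<forall>j. s j c \<in> R) \<and> (z \<notin> R \<longrightarrow> c - 1 \<in> max_ideal R)
           \<and> (\<forall>j. s j z \<in> max_ideal R \<longrightarrow> s j c \<in> max_ideal R)"
proof -
  interpret R: vring L R by unfold_locales (rule R)
  \<comment> \<open>The primes for which the denominator fails to be a unit at the conjugate
    \<open>s j z\<close>; each \<open>j\<close> contributes at most one.\<close>
  define bad where "bad j = {n. prime n \<and> s j z \<in> R \<and> (\<Sum>k<n. s j z ^ k) \<in> R.M}" for j
  have "finite (bad j)" for j
  proof (cases "bad j = {}")
    case False
    then obtain m where m: "m \<in> bad j" by auto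
    have "n = m" if "n \<in> bad j" for n
      using R.geometric_sum_unit[of "s j z" m n] m that by (auto simp: bad_def)
    then have "bad j \<subseteq> {m}" by auto
    then show ?thesis using finite_subset by blast
  qed auto
  then have "finite (\<Union>j<p. bad j)" by auto
  then have "infinite ({n::nat. prime n} - (\<Union>j<p. bad j))"
    using primes_infinite by (rule Diff_infinite_finite)
  then have "{n::nat. prime n} - (\<Union>j<p. bad j) \<noteq> {}" by (rule infinite_imp_nonempty)
  then obtain n where n: "prime n" "\<And>j. j < p \<Longrightarrow> n \<notin> bad j" by blast
  have unit: "(\<Sum>k<n. s j z ^ k) \<notin> R.M" if "s j z \<in> R" for j
  proof -
    have "s j = s (j mod p)" using s_mod[of "j div p" "j mod p"] by simp
    then show ?thesis using n(2)[of "j mod p"] n(1) p_gt that by (auto simp: bad_def)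
  qed
  \<comment> \<open>\<open>n \<ge> 2\<close> gives the numerator a positive exponent, so that it
    lies in the maximal ideal whenever \<open>s j z\<close> does.\<close>
  obtain n' where n': "n = Suc (Suc n')"
    using prime_gt_1_nat[OF n(1)] by (metis One_nat_def Suc_less_eq gr0_implies_Suc less_imp_Suc_add)
  define c where "c = z ^ (n - 1) / (\<Sum>k<n. z ^ k)"
  have sc: "s j c = s j z ^ (n - 1) / (\<Sum>k<n. s j z ^ k)" for j
    unfolding c_def using z
    by (simp add: gal_divide[OF s_gal] gal_power[OF s_gal] gal_sum[OF s_gal] L.power L.sum)
  have outside: "s j c \<in> R \<and> s j c - 1 \<in> R.M" if out: "s j z \<notin> R" for j
  proof -
    define v where "v = inverse (s j z)"
    have v: "v \<in> R.M" unfolding v_def using out z gal_in[OF s_gal] R.inverse_M by auto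
    have w0: "s j z \<noteq> 0" using out by auto
    define e where "e = (\<Sum>k<n. v ^ k)"
    have "e - 1 = (\<Sum>k<Suc n'. v * v ^ k)" unfolding e_def n' by (subst sum.lessThan_Suc_shift) simp
    also have "\<dots> \<in> R.M" using v R.M_R by (intro R.M_sum R.M_mult R.power)
    finally have e1: "e - 1 \<in> R.M" .
    then have eM: "e \<notin> R.M" using R.M_cong by auto
    have eR: "e \<in> R" using R.R_of_cong[OF e1] by simp
    have "(\<Sum>k<n. s j z ^ k) = (\<Sum>k<n. s j z ^ (n - Suc k))"
      by (rule sum.nat_diff_reindex[symmetric])
    also have "\<dots> = (\<Sum>k<n. s j z ^ (n - 1) * v ^ k)"
    proof (intro sum.cong refl)
      fix k assume "k \<in> {..<n}"
      then have "inverse (s j z) ^ k * s j z ^ (n - 1) = s j z ^ (n - 1 - k)"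
        using w0 n' by (intro inverse_power_mult_power) auto
      then show "s j z ^ (n - Suc k) = s j z ^ (n - 1) * v ^ k"
        by (simp add: v_def mult.commute)
    qed
    finally have "(\<Sum>k<n. s j z ^ k) = s j z ^ (n - 1) * e"
      by (simp add: e_def sum_distrib_left)
    then have se: "s j c = inverse e" using w0 by (simp add: sc field_simps)
    have e0: "e \<noteq> 0" using eM by auto
    then have "inverse e - 1 = - ((e - 1) * inverse e)" by (simp add: algebra_simps)
    also have "\<dots> \<in> R.M" using e1 eR eM by (intro R.M_minus R.M_mult R.inverse_unit)
    finally show ?thesis using se R.inverse_unit[OF eR eM] by simp
  qed
  have inside: "s j c \<in> R \<and> (s j z \<in> R.M \<longrightarrow> s j c \<in> R.M)" if ins: "s j z \<in> R" for j
  proof -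
    have inv: "inverse (\<Sum>k<n. s j z ^ k) \<in> R"
      using unit[OF ins] ins by (intro R.inverse_unit R.sum R.power)
    have "s j z ^ (n - 1) \<in> R.M" if "s j z \<in> R.M"
      using that ins unfolding n' by (auto intro!: R.M_mult R.mult R.power)
    then show ?thesis
      unfolding sc divide_inverse using inv ins by (auto intro!: R.mult R.M_mult R.power)
  qed
  show ?thesis
  proof (intro bexI[of _ c] conjI allI impI)
    show "c \<in> L" unfolding c_def using z by (intro L.divide L.power L.sum)
    show "s j c \<in> R" for j using inside outside by blast
    show "c - 1 \<in> R.M" if "z \<notin> R" using outside[of 0] that by simp
    show "s j c \<in> R.M" if "s j z \<in> R.M" for j
      using inside R.M_R that by blast
  qed
qed

lemma M_Int_K:
  assumes "R \<inter> K = A" "x \<in> K" shows "x \<in> max_ideal R \<longleftrightarrow> x \<in> max_ideal A"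
  using assms K.inverse by (auto simp: max_ideal_def)

text \<open>If the extension were not stable, its \<open>p\<close> conjugates would be pairwise incomparable, and an element
  congruent to 1 for the first and to 0 for the others would have a characteristic polynomial
  with a simple root 1 in the residue field of \<open>A\<close>.\<close>

lemma extension_stable:
  assumes R: "valuation_ring L R" and RK: "R \<inter> K = A" and x: "x \<in> R"
  shows "\<sigma> x \<in> R"
proof (rule ccontr)
  assume x': "\<sigma> x \<notin> R"
  interpret R: vring L R by unfold_locales (rule R)
  \<comment> \<open>Some iterate of \<open>s i\<close> is \<sigma>, because \<open>i\<close> is
    invertible modulo p.\<close>
  have 1: "\<exists>u\<in>R. s i u \<notin> R" if i: "0 < i" "i < p" for i
  proof (rule ccontr)
    assume "\<not> ?thesis"
    then have *: "s i u \<in> R" if "u \<in> R" for u using that by blast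
    have "(s i ^^ k) x \<in> R" for k
      using x by (induction k) (auto intro: *)
    then have **: "s (i * k) x \<in> R" for k by (metis funpow_mult mult.commute)
    have "\<not> p dvd i" using i by (auto dest: dvd_imp_le)
    then obtain k y where "i * k = Suc (p * y)" using bezout_prime[OF p] by blast
    then have "s (i * k) = \<sigma>" using s_mod[of y 1] by simp
    with **[of k] x' show False by simp
  qed
  have "\<exists>c\<in>L. (\<forall>j. s j c \<in> R) \<and> c - 1 \<in> R.M \<and> s i c \<in> R.M" if i: "0 < i" "i < p" for i
  proof -
    obtain u where u: "u \<in> R" "s i u \<notin> R" using 1[OF i] by blast
    \<comment> \<open>The exponent p - i gives the reverse non-inclusion: a \<open>y\<close> outside
      \<open>R\<close> with \<open>s i y\<close> inside. Then \<open>y / u\<close> is outside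
      \<open>R\<close>, while its image under \<open>s i\<close> lies in the maximal ideal.\<close>
    have "0 < p - i" "p - i < p" using i by auto
    then obtain y' where y': "y' \<in> R" "s (p - i) y' \<notin> R" using 1 by blast
    define y where "y = s (p - i) y'"
    have "s i y = s (i + (p - i)) y'" unfolding y_def by (simp only: funpow_add comp_apply)
    then have y: "y \<in> L" "y \<notin> R" "s i y \<in> R"
      using y' R.sub gal_in[OF s_gal] i by (auto simp: y_def s_p)
    have uL: "u \<in> L" and u0: "u \<noteq> 0" using u R.sub gal_K[OF s_gal, of 0 i] by auto
    have zL: "y / u \<in> L" using y uL by (intro L.divide)
    have "y / u \<notin> R"
    proof
      assume "y / u \<in> R"
      then have "y / u * u \<in> R" using u by (intro R.mult)
      with y u0 show False by simp
    qed
    moreover have "s i y * inverse (s i u) \<in> R.M"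
      using y(3) u uL gal_in[OF s_gal] by (intro R.M_mult' R.inverse_M) auto
    then have "s i (y / u) \<in> R.M"
      by (simp only: gal_divide[OF s_gal y(1) uL] divide_inverse[of "s i y"])
    ultimately show ?thesis using approximation[OF R zL] by blast
  qed
  then have "\<forall>i\<in>{1..<p}. \<exists>c. c \<in> L \<and> (\<forall>j. s j c \<in> R) \<and> c - 1 \<in> R.M \<and> s i c \<in> R.M"
    by (simp add: Bex_def)
  from bchoice[OF this] obtain c where
    "\<forall>i\<in>{1..<p}. c i \<in> L \<and> (\<forall>j. s j (c i) \<in> R) \<and> c i - 1 \<in> R.M \<and> s i (c i) \<in> R.M" by blast
  then have c: "c i \<in> L" "s j (c i) \<in> R" "c i - 1 \<in> R.M" "s i (c i) \<in> R.M" if "0 < i" "i < p" for i j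
    using that by simp_all
  define b where "b = (\<Prod>i\<in>{1..<p}. c i)"
  have bL: "b \<in> L" unfolding b_def using c(1) by (intro L.prod) auto
  have sb: "s j b = (\<Prod>i\<in>{1..<p}. s j (c i))" for j
    unfolding b_def using c(1) by (intro gal_prod[OF s_gal]) auto
  have sbR: "s j b \<in> R" for j unfolding sb using c(2) by (intro R.prod) auto
  have b1: "b - 1 \<in> R.M"
  proof -
    have "(\<Prod>i\<in>{1..<p}. c i) - (\<Prod>i\<in>{1..<p}. 1) \<in> R.M"
      using c(2)[of _ 0] c(3) by (intro R.M_cong_prod) auto
    then show ?thesis by (simp add: b_def)
  qed
  have sbM: "s j b \<in> R.M" if "0 < j" "j < p" for j
    unfolding sb using c that by (intro R.M_prodI[of _ _ j]) auto
  \<comment> \<open>\<open>b\<close> is congruent to 1 and its other conjugates to 0, so over the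
    residue field \<chi> becomes (X - 1) X^(p-1).\<close>
  define \<chi> where "\<chi> = charpoly b"
  define \<rho> where "\<rho> = (\<Prod>j\<in>{1..<p}. [:- s j b, 1:])"
  have split: "{..<p} = insert 0 {1..<p}" using p_gt by auto
  have \<chi>: "\<chi> = [:- b, 1:] * \<rho>" unfolding \<chi>_def charpoly_def \<rho>_def split by simp
  have \<rho>R: "\<rho> \<in> R.polys" unfolding \<rho>_def using sbR
    by (intro R.polys_prod R.polys_pCons R.minus) auto
  have \<chi>K: "\<chi> \<in> K.polys" unfolding \<chi>_def by (rule charpoly_K[OF bL])
  have \<chi>R: "\<chi> \<in> R.polys" unfolding \<chi> using \<rho>R sbR[of 0]
    by (intro R.polys_mult R.polys_pCons R.minus) auto
  have \<chi>A: "\<chi> \<in> A.polys"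
    using R.polysD[OF \<chi>R] K.polysD[OF \<chi>K] by (intro A.polysI) (simp flip: RK)
  have "(1 - b) * poly \<rho> 1 \<in> R.M"
    using R.M_minus[OF b1] R.poly_in[OF \<rho>R R.one] by (intro R.M_mult) simp_all
  then have "poly \<chi> 1 \<in> R.M" by (simp add: \<chi> algebra_simps)
  moreover have "poly (pderiv \<chi>) 1 \<notin> R.M"
  proof -
    have "poly (pderiv \<chi>) 1 - poly \<rho> 1 = (1 - b) * poly (pderiv \<rho>) 1"
      unfolding \<chi> pderiv_mult by (simp add: pderiv_pCons algebra_simps)
    also have "\<dots> \<in> R.M"
      using R.M_minus[OF b1] \<rho>R by (intro R.M_mult R.poly_in R.polys_pderiv) auto
    finally have "poly (pderiv \<chi>) 1 - poly \<rho> 1 \<in> R.M" .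
    moreover have "poly \<rho> 1 \<notin> R.M"
    proof
      assume "poly \<rho> 1 \<in> R.M"
      then have "(\<Prod>j\<in>{1..<p}. 1 - s j b) \<in> R.M" by (simp add: \<rho>_def poly_prod)
      then obtain j where "j \<in> {1..<p}" and j1: "1 - s j b \<in> R.M"
        using R.M_prod[of "{1..<p}" "\<lambda>j. 1 - s j b"] sbR R.diff by auto
      then have j: "0 < j" "j < p" "1 - s j b \<in> R.M" by auto
      then show False using R.M_add[OF j(3) sbM[of j]] by auto
    qed
    ultimately show ?thesis using R.M_cong by blast
  qed
  ultimately have "poly \<chi> 1 \<in> A.M \<and> poly (pderiv \<chi>) 1 \<notin> A.M"
    using M_Int_K[OF RK] A.sub A.poly_in[OF \<chi>A] A.poly_in[OF A.polys_pderiv[OF \<chi>A]] by auto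
  moreover have "(\<forall>i. coeff \<chi> i \<in> A) \<and> lead_coeff \<chi> = 1"
    using A.polysD[OF \<chi>A] charpoly_monic[of b] by (simp add: \<chi>_def)
  ultimately obtain r where r: "r \<in> A" "poly \<chi> r = 0"
    using hens[unfolded henselian_def, rule_format, of \<chi> 1] by auto
  \<comment> \<open>A root of \<chi> in A is a conjugate of \<open>b\<close>; being fixed by
    \<sigma>, it equals \<open>b\<close>. Then \<open>b\<close> is congruent to 1 but equal to
    \<open>s 1 b\<close>, which is congruent to 0.\<close>
  then obtain j where j: "j < p" "r = s j b" unfolding \<chi>_def poly_charpoly by auto
  have rK: "r \<in> K" using r A.sub by auto
  have "b = s (p - j + j) b" using j by (simp add: s_p)
  also have "\<dots> = s (p - j) r" unfolding j(2) by (simp only: funpow_add comp_apply)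
  also have "\<dots> = r" using rK by (rule gal_K[OF s_gal])
  finally have "b = r" .
  then have "s 1 b = b" using gal_K[OF s_gal rK] by blast
  then have "b \<in> R.M" using sbM[of 1] p_gt by auto
  then show False using R.M_diff[OF _ b1] by fastforce
qed

text \<open>A valuation ring \<open>R\<close> of L above A contains the integral closure.
  Conversely, by stability the conjugates of an element of \<open>R\<close> lie in \<open>R\<close>,
  so its characteristic polynomial has coefficients in \<open>R \<inter> K\<close>, which is
  A.\<close>

lemma B_valuation: "valuation_ring L B" and B_Int_K: "B \<inter> K = A" and B_\<sigma>: "x \<in> B \<Longrightarrow> \<sigma> x \<in> B"
proof -
  obtain R where R: "valuation_ring L R" and RK: "R \<inter> K = A"
    using A.chevalley_extension[OF L.subfield KL] by blast
  interpret R: vring L R by unfold_locales (rule R)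
  have "B = R"
  proof
    show "B \<subseteq> R"
    proof
      fix x assume "x \<in> B"
      then obtain f where f: "x \<in> L" "\<And>i. coeff f i \<in> A" "lead_coeff f = 1" "poly f x = 0"
        by (auto simp: B_def int_closure_def)
      then have "f \<in> R.polys" using RK by (intro R.polysI) auto
      then show "x \<in> R" using f R.monic_root_in_R by blast
    qed
    show "R \<subseteq> B"
    proof
      fix x assume x: "x \<in> R"
      have "s j x \<in> R" for j using x extension_stable[OF R RK] by (induction j) auto
      then have "charpoly x \<in> R.polys"
        unfolding charpoly_def by (intro R.polys_prod R.polys_pCons R.minus) auto
      then have "coeff (charpoly x) i \<in> A" for i
        using R.polysD K.polysD[OF charpoly_K] R.sub[OF x] RK by blast
      then show "x \<in> B"
        using R.sub[OF x] charpoly_monic charpoly_root unfolding B_def int_closure_def by blast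
    qed
  qed
  then show "valuation_ring L B" "B \<inter> K = A" "x \<in> B \<Longrightarrow> \<sigma> x \<in> B"
    using R RK extension_stable[OF R RK] by auto
qed

section \<open>Values in L and their invariance under \<sigma>\<close>

sublocale B: vring L B
  by unfold_locales (rule B_valuation)

lemma AB: "x \<in> A \<Longrightarrow> x \<in> B" using B_Int_K by auto

lemma M_iff: "x \<in> K \<Longrightarrow> x \<in> B.M \<longleftrightarrow> x \<in> A.M" by (rule M_Int_K[OF B_Int_K])

lemma B_s: "x \<in> B \<Longrightarrow> s j x \<in> B"
  by (induction j) (auto intro: B_\<sigma>)

lemma polys_AB: "f \<in> A.polys \<Longrightarrow> f \<in> B.polys"
  by (auto simp: A.polys_def B.polys_def AB)

lemma M_\<sigma>: assumes "x \<in> B.M" shows "\<sigma> x \<in> B.M"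
proof (cases "x = 0")
  case False
  have xL: "x \<in> L" using assms B.M_R B.sub by blast
  have "inverse (\<sigma> x) \<notin> B"
  proof
    assume "inverse (\<sigma> x) \<in> B"
    then have "\<sigma> (inverse x) \<in> B" using gal_inverse[OF \<sigma> xL] by simp
    then have "s (p - 1) (\<sigma> (inverse x)) \<in> B" by (rule B_s)
    also have "s (p - 1) (\<sigma> (inverse x)) = s (p - 1 + 1) (inverse x)"
      by (simp add: funpow_swap1)
    also have "\<dots> = inverse x" using p_gt by (simp add: s_p del: funpow.simps)
    finally show False using assms False by (auto simp: max_ideal_def)
  qed
  then show ?thesis using B.M_R[OF assms] B_\<sigma> by (auto simp: max_ideal_def)
qed (use gal_K[OF \<sigma>] in auto)

lemma M_s: "x \<in> B.M \<Longrightarrow> s j x \<in> B.M"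
  by (induction j) (auto intro: M_\<sigma>)

lemma norm_A: assumes "x \<in> B" shows "N x \<in> A"
proof -
  have "N x \<in> B" unfolding norm_eq using B_s[OF assms] by (intro B.prod)
  then show ?thesis using norm_K[OF B.sub[OF assms]] B_Int_K by blast
qed

text \<open>\<open>x\<close> and \<sigma> x have the same norm, so \<open>x / \<sigma> x\<close> has
  norm 1 and cannot lie in the maximal ideal, whose elements have norms in it.\<close>

lemma ratio_B: assumes x: "x \<in> L" "x \<noteq> 0" shows "\<sigma> x / x \<in> B"
proof (rule ccontr)
  assume out: "\<sigma> x / x \<notin> B"
  define y where "y = inverse (\<sigma> x / x)"
  have uL: "\<sigma> x / x \<in> L" using x gal_in[OF \<sigma>] by (intro L.divide)
  have y: "y \<in> B.M" unfolding y_def using out uL by (rule B.inverse_M[rotated])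
  then have "N y \<in> B.M"
    unfolding norm_eq using p_gt M_s B.M_R by (intro B.M_prodI[of _ _ 0]) auto
  moreover have "N y = N x / N (\<sigma> x)"
    using x gal_in[OF \<sigma>] by (simp add: y_def norm_divide)
  then have "N y = 1" using x by (simp add: norm_\<sigma> norm_eq_0)
  ultimately show False by simp
qed

lemma ratio_inverse_B: assumes x: "x \<in> L" "x \<noteq> 0" shows "x / \<sigma> x \<in> B"
proof -
  have "\<sigma> (inverse x) / inverse x \<in> B" using x L.inverse by (intro ratio_B) auto
  then show ?thesis using x by (simp add: gal_inverse[OF \<sigma>] divide_inverse mult.commute)
qed

lemma ratio_s: assumes x: "x \<in> L" "x \<noteq> 0" shows "x / s j x \<in> B" "s j x / x \<in> B"
proof -
  have *: "s j x \<in> L" "s j x \<noteq> 0" for j using x gal_in[OF s_gal] gal_eq_0[OF s_gal] by auto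
  show "x / s j x \<in> B"
  proof (induction j)
    case (Suc j)
    have "x / s j x * (s j x / s (Suc j) x) \<in> B"
      using Suc ratio_inverse_B[OF *[of j]] by (intro B.mult) auto
    then show ?case using *(2)[of j] by simp
  qed (use x in auto)
  show "s j x / x \<in> B"
  proof (induction j)
    case (Suc j)
    have "s (Suc j) x / s j x * (s j x / x) \<in> B"
      using Suc ratio_B[OF *[of j]] by (intro B.mult) auto
    then show ?case using *(2)[of j] by simp
  qed (use x in auto)
qed

end

section \<open>Residues\<close>

text \<open>Only the two top terms contribute. The formula serves to read off the root of a power (X
  - u)^e and to remove a second coefficient by a shift.\<close>

lemma coeff_shift_pred:
  fixes f :: "'a::field_char_0 poly"
  assumes "0 < degree f"
  shows "coeff (pcompose f [:a, 1:]) (degree f - 1) = coeff f (degree f - 1) + of_nat (degree f) * lead_coeff f * a"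
proof -
  obtain d where d: "degree f = Suc d" using assms by (cases "degree f") auto
  have "coeff (pcompose f [:a, 1:]) d = (\<Sum>i<d. coeff f i * (of_nat (i choose d) * a ^ (i - d)))
      + coeff f d + coeff f (Suc d) * (of_nat (Suc d) * a)"
    unfolding coeff_pcompose_shift d by (simp add: lessThan_Suc_atMost[symmetric] del: of_nat_Suc)
  also have "(\<Sum>i<d. coeff f i * (of_nat (i choose d) * a ^ (i - d))) = 0"
    by (intro sum.neutral) (auto simp: binomial_eq_0)
  finally show ?thesis by (simp add: d mult_ac)
qed

lemma pcompose_shift_shift:
  fixes f :: "'a::field_char_0 poly"
  shows "pcompose (pcompose f [:a, 1:]) [:- a, 1:] = f"
  by (rule poly_ext) (simp add: poly_pcompose)

context vring
begin

lemma M_coeff_shift: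
  assumes "\<And>i. coeff f i \<in> M" "a \<in> R" shows "coeff (pcompose f [:a, 1:]) k \<in> M"
  unfolding coeff_pcompose_shift using assms by (intro M_sum M_mult mult power) auto

end

context kummer_val
begin

lemma of_nat_unit: assumes "\<not> p dvd k" shows "of_nat k \<notin> A.M"
proof (cases "k = 1")
  case False
  have "coprime p k" using p assms by (simp add: prime_imp_coprime)
  then show ?thesis using A.of_nat_coprime[OF pM _ False] by blast
qed simp

text \<open>Coefficients in the maximal ideal do not affect the residue of the value: cut
  \<open>f\<close> off above its last unit coefficient and normalise. The degree is positive because
  the constant 1 has no root.\<close>

lemma monic_witness:
  assumes f: "f \<in> A.polys" "coeff f i \<notin> A.M" and u: "u \<in> B" "poly f u \<in> B.M"
  shows "\<exists>q\<in>A.polys. lead_coeff q = 1 \<and> 0 < degree q \<and> degree q \<le> degree f \<and> poly q u \<in> B.M"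
proof -
  define e where "e = Max {i. coeff f i \<notin> A.M}"
  have fin: "finite {i. coeff f i \<notin> A.M}"
    by (rule finite_subset[of _ "{..degree f}"]) (auto intro!: le_degree)
  have e: "coeff f e \<notin> A.M"
    using Max_in[OF fin] f(2) unfolding e_def by blast
  have above: "coeff f j \<in> A.M" if "j > e" for j
    using Max_ge[OF fin, of j] that unfolding e_def by fastforce
  have e_le: "e \<le> degree f" using e by (intro le_degree) auto
  define c where "c = coeff f e"
  have c: "c \<in> A" "c \<notin> A.M" "c \<noteq> 0" using e A.polysD[OF f(1)] by (auto simp: c_def)
  have ic: "inverse c \<in> A" using c by (intro A.inverse_unit)
  define q where "q = (\<Sum>j\<le>e. monom (inverse c * coeff f j) j)"
  have qA: "q \<in> A.polys"
    unfolding q_def using ic A.polysD[OF f(1)] by (intro A.polys_sum A.polys_monom A.mult)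
  have qe: "coeff q e = 1" using c by (simp add: q_def coeff_sum c_def)
  have "degree q \<le> e" unfolding q_def by (intro degree_sum_le) (auto intro: order.trans[OF degree_monom_le])
  moreover have "e \<le> degree q" using qe by (intro le_degree) auto
  ultimately have dq: "degree q = e" by simp
  have "{..degree f} = {..e} \<union> {e<..degree f}" using e_le by auto
  then have "poly f u = (\<Sum>j\<le>e. coeff f j * u ^ j) + (\<Sum>j\<in>{e<..degree f}. coeff f j * u ^ j)"
    unfolding poly_altdef by (simp, subst sum.union_disjoint) auto
  then have "(\<Sum>j\<le>e. coeff f j * u ^ j) = poly f u - (\<Sum>j\<in>{e<..degree f}. coeff f j * u ^ j)"
    by simp
  also have "\<dots> \<in> B.M"
    using above u M_iff A.sub A.M_R
    by (intro B.M_diff B.M_sum B.M_mult B.power) auto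
  finally have "inverse c * (\<Sum>j\<le>e. coeff f j * u ^ j) \<in> B.M"
    by (rule B.M_mult'[OF _ AB[OF ic]])
  then have qu: "poly q u \<in> B.M"
    by (simp add: q_def poly_sum poly_monom sum_distrib_left mult.assoc)
  have "e \<noteq> 0"
  proof
    assume "e = 0"
    then have "q = 1" using qe dq by (metis degree_0_id one_pCons coeff_pCons_0 of_nat_1 of_nat_eq_1_iff)
    with qu show False by simp
  qed
  then show ?thesis using qA qe dq e_le qu by (intro bexI[of _ q]) auto
qed

text \<open>The residue of \<open>u\<close> is purely inseparable over the residue field of \<open>A\<close>, as \<open>u ^ p\<close> is congruent to the norm
  of \<open>u\<close>. If \<open>q\<close> divides \<open>X ^ p - N u = (X - u) ^ p\<close> in the residue field, then \<open>q = (X - u) ^ e\<close>, whose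
  second coefficient \<open>- e u\<close> gives \<open>u\<close>; otherwise the remainder has smaller degree.\<close>

lemma residue_in_A:
  assumes u: "u \<in> B" "\<sigma> u - u \<in> B.M"
    and q: "q \<in> A.polys" "lead_coeff q = 1" "0 < degree q" "degree q < p" "poly q u \<in> B.M"
  shows "\<exists>a\<in>A. u - a \<in> B.M"
  using q
proof (induction "degree q" arbitrary: q rule: less_induct)
  case less
  note q = less.prems
  define e where "e = degree q"
  define w where "w = N u"
  have w: "w \<in> A" unfolding w_def by (rule norm_A[OF u(1)])
  have su: "s j u - u \<in> B.M" for j
  proof (induction j)
    case (Suc j)
    have "\<sigma> (s j u - u) + (\<sigma> u - u) \<in> B.M" using Suc u by (intro B.M_add M_\<sigma>)
    then show ?case
      using gal_diff[OF \<sigma> gal_in[OF s_gal[of j] B.sub[OF u(1)]] B.sub[OF u(1)]] by simp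
  qed simp
  have "(\<Prod>j<p. s j u) - (\<Prod>j<p. u) \<in> B.M"
    using su u B_s by (intro B.M_cong_prod) auto
  then have wM: "w - u ^ p \<in> B.M" by (simp add: w_def norm_eq)
  define F where "F = monom 1 p - [:w:]"
  have FA: "F \<in> A.polys" unfolding F_def
    using w by (intro A.polys_diff A.polys_monom A.polys_pCons) auto
  obtain S r where S: "S \<in> A.polys" and r: "r \<in> A.polys" and Fqr: "F = q * S + r" and dr: "degree r < e"
    using A.monic_division[OF FA q(1,2,3)] by (auto simp: e_def)
  have Fu: "poly F u \<in> B.M"
    using B.M_minus[OF wM] by (simp add: F_def poly_monom)
  show ?case
  proof (cases "\<exists>i. coeff r i \<notin> A.M")
    case True
    then obtain i where i: "coeff r i \<notin> A.M" by blast
    have "poly r u = poly F u - poly q u * poly S u" by (simp add: Fqr)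
    also have "\<dots> \<in> B.M"
      using Fu q(5) B.poly_in[OF polys_AB[OF S] u(1)] by (intro B.M_diff B.M_mult)
    finally obtain q' where "q' \<in> A.polys" "lead_coeff q' = 1" "0 < degree q'" "degree q' \<le> degree r"
      "poly q' u \<in> B.M"
      using monic_witness[OF r i u(1)] by blast
    then show ?thesis using less.hyps[of q'] dr q(4) by (simp add: e_def)
  next
    case False
    then have rM: "coeff r i \<in> B.M" for i using M_iff A.sub[OF A.polysD[OF r]] by blast
    \<comment> \<open>Centered at \<open>u\<close>, the product \<open>H\<close> of the two factors
      is X^p over the residue field of B, since \<open>w\<close> cancels \<open>u ^ p\<close> and
      the inner binomial coefficients are divisible by p.\<close>
    define Q where "Q = pcompose q [:u, 1:]"
    define T where "T = pcompose S [:u, 1:]"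
    define H where "H = Q * T"
    have X: "[:u, 1:] \<in> B.polys" using u by (intro B.polys_pCons) auto
    have QB: "Q \<in> B.polys" and TB: "T \<in> B.polys"
      unfolding Q_def T_def using X S q(1) polys_AB by (auto intro: B.polys_pcompose)
    have "H = pcompose (F - r) [:u, 1:]" by (simp add: H_def Q_def T_def Fqr pcompose_mult)
    also have "\<dots> = [:u, 1:] ^ p - [:w:] - pcompose r [:u, 1:]"
      by (rule poly_ext) (simp add: F_def poly_pcompose poly_monom)
    finally have H: "coeff H k = coeff ([:u, 1:] ^ p) k - coeff [:w:] k - coeff (pcompose r [:u, 1:]) k" for k
      by simp
    have rM': "coeff (pcompose r [:u, 1:]) k \<in> B.M" for k
      using rM u(1) by (rule B.M_coeff_shift)
    have H_M: "coeff H k \<in> B.M" if "k \<noteq> p" for k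
    proof -
      have "coeff ([:u, 1:] ^ p) k - coeff [:w:] k \<in> B.M"
      proof (cases "k = 0 \<or> k > p")
        case True
        then show ?thesis
        proof
          assume "k = 0"
          then show ?thesis using B.M_minus[OF wM] by (simp add: coeff_0_power)
        next
          assume "k > p"
          moreover have "degree ([:u, 1:] ^ p) \<le> p" using degree_power_le[of "[:u, 1:]" p] by simp
          ultimately show ?thesis by (simp add: coeff_eq_0 coeff_pCons split: nat.splits)
        qed
      next
        case False
        with that have k: "0 < k" "k < p" by auto
        then have "p dvd (p choose k)" using p by (intro dvd_choose_prime) auto
        then obtain c where "p choose k = p * c" by (rule dvdE)
        then have "coeff ([:u, 1:] ^ p) k = of_nat p * (of_nat c * u ^ (p - k))"
          using k by (simp add: coeff_linear_poly_power)
        moreover have "of_nat p \<in> B.M" using pM M_iff by auto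
        ultimately show ?thesis
          using k u by (auto simp: coeff_pCons split: nat.splits intro!: B.M_mult B.mult B.power)
      qed
      then show ?thesis unfolding H using rM' by (rule B.M_diff)
    qed
    have H_p: "coeff H p \<notin> B.M"
    proof
      assume "coeff H p \<in> B.M"
      then have "coeff H p + coeff (pcompose r [:u, 1:]) p \<in> B.M" using rM' by (intro B.M_add)
      moreover have "coeff [:w:] p = 0" using p_gt by (simp add: coeff_pCons split: nat.splits)
      ultimately show False by (simp add: H coeff_linear_power)
    qed
    have Qe: "coeff Q e = 1"
    proof -
      have "degree Q = e" by (simp add: Q_def e_def degree_pcompose)
      moreover have "lead_coeff Q = 1" unfolding Q_def using q(2) by (subst lead_coeff_comp) auto
      ultimately show ?thesis by simp
    qed
    \<comment> \<open>Lowest indices of nonzero residues add up under multiplication, so i + j = p.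
      As \<open>j \<le> degree S\<close> and e + degree S = p, this gives \<open>e \<le> i\<close>:
      over the residue field \<open>Q\<close> is X^e.\<close>
    define i where "i = (LEAST i. coeff Q i \<notin> B.M)"
    define j where "j = (LEAST j. coeff T j \<notin> B.M)"
    have ei: "coeff Q i \<notin> B.M" unfolding i_def by (rule LeastI[of _ e]) (simp add: Qe)
    have "\<exists>j. coeff T j \<notin> B.M"
    proof (rule ccontr)
      assume "\<not> ?thesis"
      then have "coeff H p \<in> B.M"
        unfolding H_def coeff_mult using B.polysD[OF QB] by (intro B.M_sum B.M_mult') auto
      with H_p show False by contradiction
    qed
    then have ej: "coeff T j \<notin> B.M" unfolding j_def by (rule LeastI_ex)
    have Q_less: "coeff Q k \<in> B.M" if "k < i" for k using not_less_Least[of k] that unfolding i_def by blast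
    have T_less: "coeff T k \<in> B.M" if "k < j" for k using not_less_Least[of k] that unfolding j_def by blast
    have "coeff H (i + j) \<notin> B.M"
    proof
      assume "coeff H (i + j) \<in> B.M"
      moreover have "coeff H (i + j) = coeff Q i * coeff T j + (\<Sum>k\<in>{..i + j} - {i}. coeff Q k * coeff T (i + j - k))"
        unfolding H_def coeff_mult by (subst sum.remove[of _ i]) auto
      moreover have "(\<Sum>k\<in>{..i + j} - {i}. coeff Q k * coeff T (i + j - k)) \<in> B.M"
      proof (intro B.M_sum)
        fix k assume "k \<in> {..i + j} - {i}"
        then have "k < i \<or> i + j - k < j" by auto
        then show "coeff Q k * coeff T (i + j - k) \<in> B.M"
          using Q_less T_less B.polysD[OF QB] B.polysD[OF TB] by (auto intro: B.M_mult B.M_mult')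
      qed
      ultimately have "coeff Q i * coeff T j \<in> B.M" using B.M_diff by fastforce
      then show False using B.M_prime[OF B.polysD[OF QB] B.polysD[OF TB]] ei ej by blast
    qed
    then have ij: "i + j = p" using H_M by blast
    have "degree (q * S) = p"
    proof -
      have "q * S = monom 1 p + - ([:w:] + r)" using Fqr by (simp add: F_def algebra_simps)
      moreover have "degree (- ([:w:] + r)) < p"
        using dr q(4) unfolding degree_minus by (intro degree_add_less) (auto simp: e_def)
      then have "degree (monom 1 p + - ([:w:] + r)) = degree (monom (1 :: 'a) p)"
        by (intro degree_add_eq_left) (simp add: degree_monom_eq)
      ultimately show ?thesis by (simp add: degree_monom_eq)
    qed
    moreover from this have "q \<noteq> 0" "S \<noteq> 0" using p_gt by auto
    ultimately have "e + degree S = p" by (simp add: degree_mult_eq e_def)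
    moreover have "j \<le> degree T" using ej by (intro le_degree) auto
    then have "j \<le> degree S" by (simp add: T_def degree_pcompose)
    ultimately have "e \<le> i" using ij by simp
    then have "coeff Q (e - 1) \<in> B.M" using q(3) by (intro Q_less) (simp add: e_def)
    then have *: "coeff q (e - 1) + of_nat e * u \<in> B.M"
      unfolding Q_def e_def using q(2,3) by (subst (asm) coeff_shift_pred) auto
    have "\<not> p dvd e" using q(3,4) by (auto simp: e_def dest: dvd_imp_le)
    then have eM: "of_nat e \<notin> A.M" by (rule of_nat_unit)
    then have ie: "inverse (of_nat e) \<in> A" by (intro A.inverse_unit) auto
    have e0: "of_nat e \<noteq> (0 :: 'a)" using q(3) by (simp add: e_def)
    have "(coeff q (e - 1) + of_nat e * u) * inverse (of_nat e) \<in> B.M"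
      using * AB[OF ie] by (rule B.M_mult)
    also have "(coeff q (e - 1) + of_nat e * u) * inverse (of_nat e) = u - (- (coeff q (e - 1) * inverse (of_nat e)))"
      using e0 by (simp add: distrib_right)
    finally show ?thesis
      using A.minus[OF A.mult[OF A.polysD[OF q(1)] ie]] by blast
  qed
qed

end

section \<open>Expansions in powers of a linear element\<close>

context kummer_val
begin

text \<open>If \<open>x^n\<close> has a value of \<open>K\<close> for some \<open>n\<close> prime to \<open>p\<close>, so has \<open>x\<close>, because \<open>x ^ p\<close> has the value of \<open>N x\<close>.\<close>

lemma value_in_K:
  assumes x: "x \<in> L" "x \<noteq> 0" and n: "0 < n" "n < p" and c: "c \<in> K" "c \<noteq> 0"
    and eq: "x ^ n / c \<in> B" "c / x ^ n \<in> B"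
  shows "\<exists>t\<in>K. t \<noteq> 0 \<and> x / t \<in> B \<and> t / x \<in> B"
proof -
  have "\<not> p dvd n" using n by (auto dest: dvd_imp_le)
  then obtain a b where ab: "n * a = Suc (p * b)" using bezout_prime[OF p] by blast
  define w where "w = N x"
  have w: "w \<in> K" "w \<noteq> 0" using norm_K norm_eq_0 x by (auto simp: w_def)
  have "w / x ^ p = (\<Prod>j<p. s j x / x)"
    by (simp add: w_def norm_eq prod_dividef)
  also have "\<dots> \<in> B" using ratio_s x by (intro B.prod) auto
  finally have 1: "w / x ^ p \<in> B" .
  have "x ^ p / w = (\<Prod>j<p. x / s j x)"
    by (simp add: w_def norm_eq prod_dividef)
  also have "\<dots> \<in> B" using ratio_s x by (intro B.prod) auto
  finally have 2: "x ^ p / w \<in> B" .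
  \<comment> \<open>From n a = 1 + p b comes x = (x ^ n) ^ a / (x ^ p) ^ b; \<open>c\<close> and
    \<open>w\<close> have the values of x ^ n and x ^ p.\<close>
  define t where "t = c ^ a / w ^ b"
  have x_eq: "(x ^ n) ^ a = (x ^ p) ^ b * x" using ab by (simp flip: power_mult)
  have "x / t = (x ^ n / c) ^ a * (w / x ^ p) ^ b"
    unfolding power_divide x_eq using x w c by (simp add: t_def)
  moreover have "t / x = (c / x ^ n) ^ a * (x ^ p / w) ^ b"
    unfolding power_divide x_eq using x w c by (simp add: t_def)
  ultimately have "x / t \<in> B" "t / x \<in> B"
    using 1 2 eq by (simp_all add: B.mult B.power)
  moreover have "t \<in> K" "t \<noteq> 0" unfolding t_def using c w by (auto intro!: K.divide K.power)
  ultimately show ?thesis by blast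
qed

text \<open>\<open>good f x\<close> says that some \<open>a \<in> K\<close> makes the value of \<open>f x\<close> the minimum of the values of the terms of the
  expansion of \<open>f\<close> in powers of \<open>x - a\<close>.\<close>

definition good :: "'a poly \<Rightarrow> 'a \<Rightarrow> bool" where
  "good f x \<longleftrightarrow> (\<exists>a\<in>K. \<forall>i. coeff (pcompose f [:a, 1:]) i * (x - a) ^ i / poly f x \<in> B)"

text \<open>The term of index i about \<open>a\<close> after the substitution is \<open>d\<close>
  times the term of \<open>f\<close> about \<open>c + t * a\<close>, and the value of the polynomial
  acquires the same factor \<open>d\<close>.\<close>

lemma good_affine:
  assumes g: "good (smult d (pcompose f [:c, t:])) ((x - c) / t)"
    and c: "c \<in> K" "t \<in> K" "t \<noteq> 0" "d \<noteq> 0"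
  shows "good f x"
proof -
  obtain a where a: "a \<in> K" "\<And>i. coeff (pcompose (smult d (pcompose f [:c, t:])) [:a, 1:]) i *
      ((x - c) / t - a) ^ i / poly (smult d (pcompose f [:c, t:])) ((x - c) / t) \<in> B"
    using g by (auto simp: good_def)
  have "pcompose (smult d (pcompose f [:c, t:])) [:a, 1:] = smult d (pcompose (pcompose f [:c + t * a, 1:]) [:0, t:])"
    by (rule poly_ext) (simp add: poly_pcompose algebra_simps)
  then have 1: "coeff (pcompose (smult d (pcompose f [:c, t:])) [:a, 1:]) i
      = d * (t ^ i * coeff (pcompose f [:c + t * a, 1:]) i)" for i
    by (simp add: coeff_pcompose_linear)
  have 2: "poly (smult d (pcompose f [:c, t:])) ((x - c) / t) = d * poly f x"
    using c by (simp add: poly_pcompose)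
  have 3: "(x - c) / t - a = (x - (c + t * a)) / t"
    using c by (simp add: field_simps)
  have "coeff (pcompose f [:c + t * a, 1:]) i * (x - (c + t * a)) ^ i / poly f x \<in> B" for i
    using a(2)[of i] c unfolding 1 2 3 by (simp add: power_divide)
  then show ?thesis unfolding good_def using c a K.add K.mult by blast
qed

text \<open>The induction is on the multiplicity \<open>m\<close> of \<open>0\<close> as a root of \<open>f\<close> over the residue field. If the
  terms of \<open>f u\<close> cancel, then \<open>u\<close> has the value of some \<open>t \<in> K\<close> and \<open>u / t\<close> has a residue \<open>a\<close> in that of \<open>A\<close>; Hensel's lemma
  adjusts \<open>a\<close> to a root of the derivative of order \<open>m' - 1\<close>, where \<open>m'\<close> is the multiplicity of the root \<open>a\<close>. As the
  coefficient of index \<open>m - 1\<close> vanishes while that of \<open>(X - a) ^ m\<close> does not, \<open>m' < m\<close>.\<close>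

lemma descent:
  assumes "f \<in> A.polys" "degree f < p" "coeff f m \<notin> A.M" "0 < m \<Longrightarrow> coeff f (m - 1) = 0"
    and "u \<in> B.M" "u \<notin> K" and "\<And>a. a \<in> K \<Longrightarrow> \<sigma> (u - a) / (u - a) - 1 \<in> B.M"
  shows "good f u"
  using assms
proof (induction m arbitrary: f u rule: less_induct)
  case (less m)
  note f = less.prems(1-4) and u = less.prems(5,6) and \<sigma>u = less.prems(7)
  have uB: "u \<in> B" and uL: "u \<in> L" using u B.M_R B.sub by auto
  have u0: "u \<noteq> 0" using u by auto
  have fA: "coeff f i \<in> A" and fK: "coeff f i \<in> K" and fB: "coeff f i \<in> B" for i
    using A.polysD[OF f(1)] A.sub AB by auto
  define g where "g i = coeff f i * u ^ i" for i
  have gL: "g i \<in> L" for i unfolding g_def by (intro L.mult L.power uL B.sub[OF fB])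
  have fm0: "coeff f m \<noteq> 0" using f(3) by auto
  then have gm0: "g m \<noteq> 0" using u0 by (simp add: g_def)
  obtain i0 where i0: "i0 \<le> m" "g i0 \<noteq> 0" "\<And>j. j \<le> m \<Longrightarrow> g j / g i0 \<in> B"
    using B.exists_min_value[of "{..m}" g] gL gm0 by auto
  \<comment> \<open>\<open>coeff f m\<close> is a unit and \<open>u\<close> lies in the maximal
    ideal, so a term beyond index m has larger value than the term at m, hence than the one at
    i0.\<close>
  have g_above: "g i / g i0 \<in> B.M" if i: "m < i" for i
  proof -
    obtain k where k: "i = m + Suc k" using less_imp_Suc_add[OF i] by auto
    have "inverse (coeff f m) \<in> B" using f(3) fA by (intro AB A.inverse_unit)
    then have "u * (u ^ k * coeff f i * inverse (coeff f m) * (g m / g i0)) \<in> B.M"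
      using u uB fB i0(3)[of m] by (intro B.M_mult B.mult B.power) auto
    also have "u * (u ^ k * coeff f i * inverse (coeff f m) * (g m / g i0)) = g i / g i0"
      using fm0 by (simp add: g_def k power_add)
    finally show ?thesis .
  qed
  have gB: "g i / g i0 \<in> B" for i using i0(3)[of i] g_above[of i] B.M_R by (cases "i \<le> m") auto
  have m_deg: "m \<le> degree f" using fm0 by (intro le_degree)
  have fu: "poly f u / g i0 = (\<Sum>i\<le>degree f. g i / g i0)"
    by (simp add: poly_altdef g_def sum_divide_distrib)
  have fuB: "poly f u / g i0 \<in> B" unfolding fu using gB by (intro B.sum)
  show ?case
  proof (cases "poly f u / g i0 \<in> B.M")
    case False
    have "g i / poly f u \<in> B" for i
    proof -
      have "g i / g i0 * inverse (poly f u / g i0) \<in> B"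
        using gB fuB False by (intro B.mult B.inverse_unit)
      then show ?thesis using i0(2) by (simp add: field_simps)
    qed
    then show ?thesis unfolding good_def
      by (intro bexI[of _ 0]) (auto simp: g_def coeff_pcompose_linear)
  next
    case True
    \<comment> \<open>Cancellation requires a second term of least value. The quotient of the two
      terms is a unit, so a power of \<open>u\<close> with exponent between 0 and p has the value of
      an element of K.\<close>
    have "\<exists>j\<le>m. j \<noteq> i0 \<and> g j / g i0 \<notin> B.M"
    proof (rule ccontr)
      assume none: "\<not> ?thesis"
      have "poly f u / g i0 = 1 + (\<Sum>i\<in>{..degree f} - {i0}. g i / g i0)"
        unfolding fu using i0 m_deg by (subst sum.remove[of _ i0]) auto
      moreover have "(\<Sum>i\<in>{..degree f} - {i0}. g i / g i0) \<in> B.M"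
      proof (intro B.M_sum)
        fix i assume "i \<in> {..degree f} - {i0}"
        then show "g i / g i0 \<in> B.M" using none g_above[of i] by (cases "i \<le> m") auto
      qed
      ultimately show False using B.M_diff[OF True] by fastforce
    qed
    then obtain j where j: "j \<le> m" "j \<noteq> i0" "g j / g i0 \<notin> B.M" by blast
    define \<epsilon> where "\<epsilon> = g j / g i0"
    have \<epsilon>: "\<epsilon> \<in> B" "inverse \<epsilon> \<in> B" "\<epsilon> \<noteq> 0"
      using gB[of j] j(3) B.inverse_unit[of \<epsilon>] B.unit_nonzero[of \<epsilon>] by (simp_all add: \<epsilon>_def)
    have nz: "coeff f j \<noteq> 0" "coeff f i0 \<noteq> 0" using \<epsilon> by (auto simp: \<epsilon>_def g_def)
    have lt_p: "i0 < p" "j < p" using i0 j m_deg f(2) by auto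
    have "\<exists>t\<in>K. t \<noteq> 0 \<and> u / t \<in> B \<and> t / u \<in> B"
    proof (cases "i0 < j")
      case True
      define c where "c = coeff f i0 / coeff f j"
      have "u ^ (j - i0) / c = \<epsilon>"
        using True u0 nz by (simp add: \<epsilon>_def g_def c_def power_diff mult.commute)
      moreover from this have "c / u ^ (j - i0) = inverse \<epsilon>" by (metis inverse_divide)
      ultimately show ?thesis
        using \<epsilon> nz fK True lt_p by (intro value_in_K[OF uL u0, of "j - i0" c]) (auto simp: c_def K.divide)
    next
      case False
      then have lt: "j < i0" using j by auto
      define c where "c = coeff f j / coeff f i0"
      have "c / u ^ (i0 - j) = \<epsilon>"
        using lt u0 nz by (simp add: \<epsilon>_def g_def c_def power_diff mult.commute)
      moreover from this have "u ^ (i0 - j) / c = inverse \<epsilon>" by (metis inverse_divide)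
      ultimately show ?thesis
        using \<epsilon> nz fK lt lt_p by (intro value_in_K[OF uL u0, of "i0 - j" c]) (auto simp: c_def K.divide)
    qed
    then obtain t where t: "t \<in> K" "t \<noteq> 0" "u / t \<in> B" "t / u \<in> B" by blast
    \<comment> \<open>Chosen so that \<psi>, which is f (t X) / d, lies over A and has coefficient 1
      at i0; then \<open>v\<close> is a unit and \<psi> has a value in the maximal ideal
      there.\<close>
    define d where "d = coeff f i0 * t ^ i0"
    have d: "d \<in> K" "d \<noteq> 0" unfolding d_def using fK t nz by (auto intro!: K.mult K.power)
    define \<psi> where "\<psi> = smult (1 / d) (pcompose f [:0, t:])"
    define v where "v = u / t"
    have vB: "v \<in> B" using t by (simp add: v_def)
    have vM: "v \<notin> B.M"
    proof
      assume "v \<in> B.M"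
      then have "v * (t / u) \<in> B.M" using t(4) by (rule B.M_mult)
      then show False using t u0 by (simp add: v_def)
    qed
    have \<psi>_coeff: "coeff \<psi> i = g i / g i0 * ((t / u) ^ i * (u / t) ^ i0)" for i
      using t u0 nz by (simp add: \<psi>_def coeff_pcompose_linear g_def d_def power_divide)
    have \<psi>B: "coeff \<psi> i \<in> B" for i
      unfolding \<psi>_coeff using gB t by (intro B.mult B.power)
    have \<psi>K: "coeff \<psi> i \<in> K" for i
      unfolding \<psi>_def using fK d t by (simp add: coeff_pcompose_linear K.mult K.power K.divide)
    have \<psi>A: "\<psi> \<in> A.polys" using \<psi>B \<psi>K B_Int_K by (intro A.polysI) blast
    have \<psi>_above: "coeff \<psi> i \<in> A.M" if "m < i" for i
    proof -
      have "coeff \<psi> i \<in> B.M"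
        unfolding \<psi>_coeff using g_above[OF that] t by (intro B.M_mult B.mult B.power)
      then show ?thesis using M_iff \<psi>K by blast
    qed
    have \<psi>_i0: "coeff \<psi> i0 = 1"
      using t nz by (simp add: \<psi>_def coeff_pcompose_linear d_def)
    have \<psi>_pred: "coeff \<psi> (m - 1) = 0" if "0 < m"
      using f(4)[OF that] by (simp add: \<psi>_def coeff_pcompose_linear)
    have \<psi>_deg: "degree \<psi> = degree f" using d t by (simp add: \<psi>_def degree_pcompose)
    have \<psi>v: "poly \<psi> v \<in> B.M"
    proof -
      have "poly f u / g i0 * (u / t) ^ i0 \<in> B.M" using True t by (intro B.M_mult B.power)
      also have "poly f u / g i0 * (u / t) ^ i0 = poly \<psi> v"
        using t u0 by (simp add: \<psi>_def poly_pcompose v_def g_def d_def power_divide)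
      finally show ?thesis .
    qed
    have "\<sigma> v - v \<in> B.M"
    proof -
      have "v * (\<sigma> u / u - 1) \<in> B.M"
        using \<sigma>u[of 0] vB by (intro B.M_mult') auto
      also have "v * (\<sigma> u / u - 1) = \<sigma> v - v"
        using t u0 uL KL by (simp add: v_def gal_divide[OF \<sigma>] gal_K[OF \<sigma>] subsetD field_simps)
      finally show ?thesis .
    qed
    moreover obtain q where "q \<in> A.polys" "lead_coeff q = 1" "0 < degree q" "degree q \<le> degree \<psi>" "poly q v \<in> B.M"
      using monic_witness[OF \<psi>A _ vB \<psi>v, of i0] \<psi>_i0 by auto
    ultimately obtain a0 where a0: "a0 \<in> A" "v - a0 \<in> B.M"
      using residue_in_A[OF vB, of q] f(2) \<psi>_deg by auto
    have a0M: "a0 \<notin> A.M"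
      using B.M_cong[OF a0(2)] vM M_iff A.sub[OF a0(1)] by blast
    define D where "D = pcompose \<psi> [:a0, 1:]"
    have DA: "D \<in> A.polys"
      unfolding D_def using \<psi>A a0 by (intro A.polys_pcompose A.polys_pCons) auto
    have D_above: "coeff D k \<in> A.M" if "m < k" for k
      unfolding D_def coeff_pcompose_shift
    proof (intro A.M_sum)
      fix i
      show "coeff \<psi> i * (of_nat (i choose k) * a0 ^ (i - k)) \<in> A.M"
        using \<psi>_above[of i] that a0
        by (cases "m < i") (auto simp: binomial_eq_0 intro!: A.M_mult A.mult A.power)
    qed
    have \<psi>_D: "\<psi> = pcompose D [:- a0, 1:]" by (simp add: D_def pcompose_shift_shift)
    have "\<exists>k. coeff D k \<notin> A.M"
    proof (rule ccontr)
      assume "\<not> ?thesis"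
      then have "coeff (pcompose D [:- a0, 1:]) i0 \<in> A.M"
        using a0 A.minus by (intro A.M_coeff_shift) auto
      then show False using \<psi>_i0 \<psi>_D by simp
    qed
    define m' where "m' = (LEAST k. coeff D k \<notin> A.M)"
    have Dm': "coeff D m' \<notin> A.M"
      unfolding m'_def by (rule LeastI_ex) fact
    have D_less: "coeff D k \<in> A.M" if "k < m'" for k
      using not_less_Least[of k] that unfolding m'_def by blast
    have "m' \<le> m" using Dm' D_above by (meson not_le)
    have "coeff D 0 \<in> A.M"
    proof -
      have "poly \<psi> v - poly \<psi> a0 \<in> B.M"
        using polys_AB[OF \<psi>A] a0(2) vB AB[OF a0(1)] by (rule B.M_cong_poly)
      then have "poly \<psi> a0 \<in> B.M" using B.M_cong \<psi>v by blast
      then have "poly \<psi> a0 \<in> A.M" using M_iff A.sub[OF A.poly_in[OF \<psi>A a0(1)]] by blast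
      then show ?thesis by (simp add: D_def)
    qed
    then have m'0: "0 < m'" using Dm' by (metis gr0I)
    \<comment> \<open>If m' = m, then \<psi> is a constant times (X - a0)^m over the residue field.
      Its coefficient of index m - 1 is, up to sign, the product of the units m, a0 and
      \<open>coeff D m\<close>, whereas \<open>\<psi>_pred\<close> makes it 0.\<close>
    have "m' \<noteq> m"
    proof
      assume mm: "m' = m"
      then have m0: "0 < m" using m'0 by simp
      have "m \<le> degree D" using Dm' mm by (intro le_degree) auto
      then have split: "coeff \<psi> (m - 1) = coeff D m * (of_nat (m choose (m - 1)) * (- a0) ^ (m - (m - 1)))
        + (\<Sum>i\<in>{..degree D} - {m}. coeff D i * (of_nat (i choose (m - 1)) * (- a0) ^ (i - (m - 1))))"
        unfolding \<psi>_D coeff_pcompose_shift by (subst sum.remove[of _ m]) auto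
      have rest: "(\<Sum>i\<in>{..degree D} - {m}. coeff D i * (of_nat (i choose (m - 1)) * (- a0) ^ (i - (m - 1)))) \<in> A.M"
      proof (intro A.M_sum A.M_mult A.mult A.power A.minus a0(1) A.of_nat)
        fix i assume "i \<in> {..degree D} - {m}"
        then have "i < m \<or> m < i" by auto
        then show "coeff D i \<in> A.M" using D_above D_less mm by blast
      qed
      have "m - (m - 1) = 1" "m choose (m - 1) = m" using m0 binomial_symmetric[of 1 m] by auto
      then have "coeff D m * (of_nat m * (- a0)) \<in> A.M"
        using A.M_minus[OF rest] split \<psi>_pred[OF m0] by (simp add: eq_neg_iff_add_eq_0[symmetric])
      then have "coeff D m \<in> A.M \<or> of_nat m * (- a0) \<in> A.M"
        by (rule A.M_prime[OF A.polysD[OF DA] A.mult[OF A.of_nat A.minus[OF a0(1)]]])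
      then have "of_nat m * (- a0) \<in> A.M" using Dm' mm by blast
      then have "of_nat m \<in> A.M \<or> - a0 \<in> A.M"
        by (rule A.M_prime[OF A.of_nat A.minus[OF a0(1)]])
      moreover have "- a0 \<notin> A.M" using A.M_minus[of "- a0"] a0M by auto
      moreover have "of_nat m \<notin> A.M"
        using m0 m_deg f(2) by (intro of_nat_unit) (auto dest: dvd_imp_le)
      ultimately show False by blast
    qed
    with \<open>m' \<le> m\<close> have m'_less: "m' < m" by simp
    define l where "l = m' - 1"
    have l: "m' = Suc l" using m'0 by (simp add: l_def)
    \<comment> \<open>The value of \<open>G\<close> at a0 is l! times \<open>coeff D l\<close>, in
      the maximal ideal, and that of its derivative is m'! times \<open>coeff D m'\<close>, a unit
      as m' < p. About a root a1 of \<open>G\<close> the coefficient of index m' - 1 vanishes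
      exactly, as the induction hypothesis requires.\<close>
    define G where "G = (pderiv ^^ l) \<psi>"
    have fact_unit: "of_nat (fact m') \<notin> A.M"
      using m'_less m_deg f(2) p by (intro of_nat_unit) (simp add: prime_dvd_fact_iff)
    have GA: "G \<in> A.polys" unfolding G_def by (rule A.polys_higher_pderiv[OF \<psi>A])
    have dG: "pderiv G = (pderiv ^^ m') \<psi>" by (simp add: G_def l)
    have "poly G a0 = of_nat (fact l) * coeff D l"
      unfolding G_def D_def fact_mult_coeff_shift by simp
    then have "poly G a0 \<in> A.M" using A.M_mult'[OF D_less[of l] A.of_nat, of "fact l"] l by simp
    moreover have Ga0: "poly (pderiv G) a0 = of_nat (fact m') * coeff D m'"
      unfolding dG D_def fact_mult_coeff_shift by simp
    have Ga0M: "poly (pderiv G) a0 \<notin> A.M"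
      unfolding Ga0 using A.M_prime[OF A.of_nat A.polysD[OF DA]] fact_unit Dm' by blast
    ultimately obtain a1 where a1: "a1 \<in> A" "poly G a1 = 0" "a1 - a0 \<in> A.M"
      using A.hensel_simple_root[OF hens GA a0(1)] by blast
    define E where "E = pcompose \<psi> [:a1, 1:]"
    have "fact l * coeff E l = 0"
      using a1(2) unfolding G_def E_def fact_mult_coeff_shift .
    then have El: "coeff E l = 0" by simp
    have Em': "coeff E m' \<notin> A.M"
    proof
      assume "coeff E m' \<in> A.M"
      then have "poly (pderiv G) a1 \<in> A.M"
        unfolding dG fact_mult_coeff_shift E_def[symmetric]
        using A.M_mult'[of "coeff E m'", OF _ A.of_nat, of "fact m'"] by simp
      moreover have "poly (pderiv G) a1 - poly (pderiv G) a0 \<in> A.M"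
        using A.polys_pderiv[OF GA] a1(3,1) a0(1) by (rule A.M_cong_poly)
      ultimately show False using Ga0M A.M_cong by blast
    qed
    have a1K: "a1 \<in> K" using a1 A.sub by blast
    have "good E (v - a1)"
    proof (rule less.IH[OF m'_less])
      show "E \<in> A.polys"
        unfolding E_def using \<psi>A a1 by (intro A.polys_pcompose A.polys_pCons) auto
      show "degree E < p" using f(2) \<psi>_deg by (simp add: E_def degree_pcompose)
      show "coeff E m' \<notin> A.M" by fact
      show "coeff E (m' - 1) = 0" using El by (simp add: l)
      have "a1 - a0 \<in> B.M" using a1(3) M_iff[of "a1 - a0"] a1K A.sub[OF a0(1)] K.diff by blast
      then have "(v - a0) - (a1 - a0) \<in> B.M" by (rule B.M_diff[OF a0(2)])
      then show "v - a1 \<in> B.M" by simp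
      show "v - a1 \<notin> K"
      proof
        assume "v - a1 \<in> K"
        then have "(v - a1 + a1) * t \<in> K" using a1K t by (intro K.mult K.add)
        then show False using u t by (simp add: v_def)
      qed
      fix a assume a: "a \<in> K"
      have b: "t * (a1 + a) \<in> K" using a a1K t by (intro K.mult K.add)
      have "v - a1 - a = (u - t * (a1 + a)) / t" using t by (simp add: v_def field_simps)
      moreover have "u - t * (a1 + a) \<in> L" "t \<in> L" using b t KL uL by (auto intro: L.diff)
      ultimately have "\<sigma> (v - a1 - a) / (v - a1 - a) = \<sigma> (u - t * (a1 + a)) / (u - t * (a1 + a))"
        using t by (simp add: gal_divide[OF \<sigma>] gal_K[OF \<sigma>])
      then show "\<sigma> (v - a1 - a) / (v - a1 - a) - 1 \<in> B.M" using \<sigma>u[OF b] by simp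
    qed
    then have "good \<psi> v"
      using a1K by (intro good_affine[of 1 \<psi> a1 1 v]) (simp_all add: E_def)
    then show ?thesis
      using t d by (intro good_affine[of "1 / d" f 0 t u]) (simp_all add: \<psi>_def v_def)
  qed
qed

lemma scale_into_M:
  assumes "finite X" "X \<subseteq> L"
  shows "\<exists>r\<in>A.M. r \<noteq> 0 \<and> (\<forall>x\<in>X. r * x \<in> B.M)"
  using assms
proof (induction X)
  case empty
  then show ?case using pM p_gt by (intro bexI[of _ "of_nat p"]) auto
next
  case (insert x X)
  then obtain r where r: "r \<in> A.M" "r \<noteq> 0" "\<And>y. y \<in> X \<Longrightarrow> r * y \<in> B.M" by auto
  have rB: "r \<in> B.M" using r(1) M_iff A.sub[OF A.M_R] by blast
  have xL: "x \<in> L" using insert.prems by auto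
  show ?case
  proof (cases "x \<in> B")
    case True
    then show ?thesis using r rB by (intro bexI[of _ r]) (auto intro: B.M_mult)
  next
    case False
    then have x0: "x \<noteq> 0" and ix: "inverse x \<in> B" using B.inverse_M[OF xL] B.M_R by auto
    \<comment> \<open>\<open>w * x\<close> is the product of the remaining conjugates of
      \<open>inverse x\<close>, so \<open>w\<close> is an element of A that clears the denominator
      of \<open>x\<close>.\<close>
    define w where "w = N (inverse x)"
    have wA: "w \<in> A" unfolding w_def using ix by (rule norm_A)
    have w0: "w \<noteq> 0" using x0 xL L.inverse norm_eq_0 by (simp add: w_def)
    have "{..<p} = insert 0 {1..<p}" using p_gt by auto
    then have "w = inverse x * (\<Prod>j\<in>{1..<p}. s j (inverse x))"
      unfolding w_def norm_eq by simp
    then have "w * x = (\<Prod>j\<in>{1..<p}. s j (inverse x))" using x0 by (simp add: field_simps)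
    also have "\<dots> \<in> B" using B_s[OF ix] by (intro B.prod)
    finally have "r * (w * x) \<in> B.M" using rB by (intro B.M_mult)
    moreover have "r * y * w \<in> B.M" if "y \<in> X" for y
      using r(3)[OF that] AB[OF wA] by (rule B.M_mult)
    ultimately show ?thesis
      using r w0 wA by (intro bexI[of _ "r * w"]) (auto simp: mult_ac intro: A.M_mult)
  qed
qed

text \<open>Preparation for \<open>descent\<close> with m = degree f: a shift and a scaling over K
  make the polynomial monic over A without second coefficient and move \<alpha> into the maximal
  ideal.\<close>

lemma good_\<alpha>:
  assumes f: "f \<in> K.polys" "f \<noteq> 0" "degree f < p"
    and \<sigma>\<alpha>': "\<And>a. a \<in> K \<Longrightarrow> \<sigma> (\<alpha> - a) / (\<alpha> - a) - 1 \<in> B.M"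
  shows "good f \<alpha>"
proof -
  define d where "d = degree f"
  define c where "c = lead_coeff f"
  have c: "c \<in> K" "c \<noteq> 0" using f K.polysD by (auto simp: c_def)
  \<comment> \<open>The shift that removes the coefficient of index d - 1. For d = 0 the division by
    0 makes it 0.\<close>
  define a where "a = - (coeff f (d - 1) / (of_nat d * c))"
  have aK: "a \<in> K" unfolding a_def using c K.polysD[OF f(1)] by (intro K.minus K.divide K.mult) auto
  define F where "F = pcompose f [:a, 1:]"
  have FK: "coeff F i \<in> K" for i
    unfolding F_def using f(1) aK by (intro K.polysD K.polys_pcompose K.polys_pCons) auto
  have dF: "degree F = d" by (simp add: F_def d_def degree_pcompose)
  have "lead_coeff F = lead_coeff f" unfolding F_def by (subst lead_coeff_comp) auto
  then have Fd: "coeff F d = c" by (simp add: dF c_def)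
  have Fpred: "coeff F (d - 1) = 0" if "0 < d"
    unfolding F_def d_def using that c
    by (subst coeff_shift_pred) (auto simp: a_def d_def c_def)
  have aL: "\<alpha> - a \<in> L" using \<alpha>L aK KL by (auto intro: L.diff)
  define X where "X = insert (\<alpha> - a) ((\<lambda>i. coeff F i / c) ` {..d})"
  have "coeff F i / c \<in> L" for i using K.divide[OF FK c(1)] KL by blast
  then have "finite X" "X \<subseteq> L" using aL by (auto simp: X_def)
  then obtain r where r: "r \<in> A.M" "r \<noteq> 0" and rX': "\<forall>x\<in>X. r * x \<in> B.M"
    using scale_into_M[of X] by blast
  have r\<alpha>: "r * (\<alpha> - a) \<in> B.M" and rF: "r * (coeff F i / c) \<in> B.M" if "i \<le> d" for i
    using rX' that unfolding X_def by blast+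
  have rK: "r \<in> K" using r A.M_R A.sub by blast
  have rA: "r \<in> A" using r A.M_R by blast
  \<comment> \<open>The coefficient of index i receives the factor r ^ (d - i); for i < d one
    \<open>r\<close> makes it integral and the others keep it so.\<close>
  define \<phi> where "\<phi> = smult (r ^ d / c) (pcompose F [:0, 1 / r:])"
  define u where "u = r * (\<alpha> - a)"
  have \<phi>_coeff: "coeff \<phi> i = r ^ (d - i) * (coeff F i / c)" if "i \<le> d" for i
    using that r by (simp add: \<phi>_def coeff_pcompose_linear power_diff power_one_over field_simps)
  have \<phi>_above: "coeff \<phi> i = 0" if "d < i" for i
    using that dF by (simp add: \<phi>_def coeff_pcompose_linear coeff_eq_0)
  have "good \<phi> u"
  proof (rule descent[of \<phi> d u])
    show "\<phi> \<in> A.polys"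
    proof (rule A.polysI)
      fix i
      consider "i < d" | "i = d" | "i > d" by linarith
      then show "coeff \<phi> i \<in> A"
      proof cases
        case 1
        then obtain k where k: "d - i = Suc k" by (metis Suc_diff_Suc)
        have "r * (coeff F i / c) \<in> B" using rF[of i] 1 B.M_R by auto
        moreover have "r * (coeff F i / c) \<in> K" using rK FK c by (intro K.mult K.divide)
        ultimately have "r * (coeff F i / c) \<in> A" using B_Int_K by blast
        then have "r ^ k * (r * (coeff F i / c)) \<in> A" by (rule A.mult[OF A.power[OF rA]])
        then show ?thesis using 1 k by (simp add: \<phi>_coeff mult_ac)
      next
        case 2
        then show ?thesis using Fd c by (simp add: \<phi>_coeff)
      qed (simp add: \<phi>_above)
    qed
    show "degree \<phi> < p" using f(3) r c dF by (simp add: \<phi>_def degree_pcompose d_def)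
    show "coeff \<phi> d \<notin> A.M" using Fd c by (simp add: \<phi>_coeff)
    show "coeff \<phi> (d - 1) = 0" if "0 < d" using Fpred[OF that] by (simp add: \<phi>_coeff)
    show "u \<in> B.M" unfolding u_def using r\<alpha>[of 0] by simp
    show "u \<notin> K"
    proof
      assume "u \<in> K"
      then have "u / r + a \<in> K" using rK aK by (intro K.add K.divide)
      then show False using r \<alpha>K by (simp add: u_def)
    qed
    fix b assume b: "b \<in> K"
    have b': "a + b / r \<in> K" using aK b rK by (intro K.add K.divide)
    have "u - b = r * (\<alpha> - (a + b / r))" using r by (simp add: u_def algebra_simps)
    moreover have "r \<in> L" "\<alpha> - (a + b / r) \<in> L" using rK b' KL \<alpha>L by (auto intro: L.diff)
    ultimately have "\<sigma> (u - b) / (u - b) = \<sigma> (\<alpha> - (a + b / r)) / (\<alpha> - (a + b / r))"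
      using r rK by (simp add: gal_mult[OF \<sigma>] gal_K[OF \<sigma>])
    then show "\<sigma> (u - b) / (u - b) - 1 \<in> B.M" using \<sigma>\<alpha>'[OF b'] by simp
  qed
  then have "good F (\<alpha> - a)"
    using r c rK by (intro good_affine[of "r ^ d / c" F 0 "1 / r" "\<alpha> - a"])
      (simp_all add: \<phi>_def u_def K.divide mult.commute)
  then show ?thesis
    using aK by (intro good_affine[of 1 f a 1 \<alpha>]) (simp_all add: F_def)
qed

lemma ratio_dominated:
  assumes x: "x \<in> L" "x \<noteq> 0"
  shows "\<exists>a\<in>K. \<exists>c\<in>B. \<sigma> x / x - 1 = c * (\<sigma> (\<alpha> - a) / (\<alpha> - a) - 1)"
proof -
  have \<alpha>a: "\<alpha> - a \<in> L" "\<alpha> - a \<noteq> 0" if "a \<in> K" for a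
    using that \<alpha>L \<alpha>K KL by (auto intro: L.diff)
  have \<rho>B: "\<sigma> (\<alpha> - a) / (\<alpha> - a) \<in> B" if "a \<in> K" for a
    using \<alpha>a[OF that] by (rule ratio_B)
  show ?thesis
  proof (cases "\<exists>a\<in>K. \<sigma> (\<alpha> - a) / (\<alpha> - a) - 1 \<notin> B.M")
    case True
    then obtain a where a: "a \<in> K" "\<sigma> (\<alpha> - a) / (\<alpha> - a) - 1 \<notin> B.M" by blast
    define e where "e = \<sigma> (\<alpha> - a) / (\<alpha> - a) - 1"
    have e: "e \<in> B" "e \<notin> B.M" "e \<noteq> 0" using a B.diff[OF \<rho>B[OF a(1)]] by (auto simp: e_def)
    \<comment> \<open>A unit divides every element of B, so here any \<open>x\<close> is
      dominated.\<close>
    have "(\<sigma> x / x - 1) * inverse e \<in> B"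
      using ratio_B[OF x] e by (intro B.mult B.diff B.inverse_unit) auto
    moreover have "\<sigma> x / x - 1 = (\<sigma> x / x - 1) * inverse e * e" using e by simp
    ultimately show ?thesis using a(1) unfolding e_def by blast
  next
    case False
    obtain f where f: "f \<in> K.polys" "degree f < p" "x = poly f \<alpha>" using L_poly_rep[OF x(1)] by blast
    have "f \<noteq> 0" using f x by auto
    then have "good f \<alpha>" using good_\<alpha> f False by blast
    then obtain a where a: "a \<in> K" and
      dom: "\<And>i. coeff (pcompose f [:a, 1:]) i * (\<alpha> - a) ^ i / x \<in> B"
      using f(3) by (auto simp: good_def)
    define y where "y = \<alpha> - a"
    define \<rho> where "\<rho> = \<sigma> y / y"
    define e where "e i = coeff (pcompose f [:a, 1:]) i" for i
    have y: "y \<in> L" "y \<noteq> 0" using \<alpha>a[OF a] by (auto simp: y_def)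
    have \<rho>: "\<rho> \<in> B" using \<rho>B[OF a] by (simp add: \<rho>_def y_def)
    have eK: "e i \<in> K" for i
      unfolding e_def using f(1) a by (intro K.polysD K.polys_pcompose K.polys_pCons) auto
    have eL: "e i \<in> L" for i using eK KL by blast
    have x_eq: "x = (\<Sum>i\<le>degree f. e i * y ^ i)"
      unfolding f(3) y_def e_def by (rule poly_shift_expand)
    have "\<sigma> x = (\<Sum>i\<le>degree f. e i * \<sigma> y ^ i)"
      unfolding x_eq using y eL
      by (simp add: gal_sum[OF \<sigma>] gal_mult[OF \<sigma>] gal_power[OF \<sigma>] gal_K[OF \<sigma> eK] L.mult L.power)
    then have "\<sigma> x - x = (\<Sum>i\<le>degree f. e i * (\<sigma> y ^ i - y ^ i))"
      unfolding x_eq by (simp add: sum_subtractf right_diff_distrib)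
    then have "\<sigma> x / x - 1 = (\<Sum>i\<le>degree f. e i * (\<sigma> y ^ i - y ^ i)) / x"
      using x by (simp add: field_simps)
    also have "\<dots> = (\<Sum>i\<le>degree f. e i * y ^ i / x * (\<Sum>k<i. \<rho> ^ k)) * (\<rho> - 1)"
      unfolding sum_divide_distrib sum_distrib_right
    proof (intro sum.cong refl)
      fix i
      have "\<sigma> y ^ i - y ^ i = y ^ i * (\<rho> ^ i - 1)"
        using y by (simp add: \<rho>_def power_divide algebra_simps)
      also have "\<rho> ^ i - 1 = (\<rho> - 1) * (\<Sum>k<i. \<rho> ^ k)" by (rule power_diff_1_eq)
      finally show "e i * (\<sigma> y ^ i - y ^ i) / x = e i * y ^ i / x * (\<Sum>k<i. \<rho> ^ k) * (\<rho> - 1)"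
        by (simp add: mult_ac)
    qed
    finally have "\<sigma> x / x - 1 = (\<Sum>i\<le>degree f. e i * y ^ i / x * (\<Sum>k<i. \<rho> ^ k)) * (\<rho> - 1)" .
    moreover have "(\<Sum>i\<le>degree f. e i * y ^ i / x * (\<Sum>k<i. \<rho> ^ k)) \<in> B"
      using dom \<rho> by (intro B.sum B.mult B.power) (auto simp: e_def y_def)
    ultimately show ?thesis using a unfolding \<rho>_def y_def by blast
  qed
qed

end

section \<open>Generated modules and the two ideals\<close>

lemma gen_module_0: "0 \<in> gen_module R S"
  unfolding gen_module_def mem_Collect_eq by (rule exI[of _ 0]) simp

lemma gen_module_add_term:
  assumes "x \<in> gen_module R S" "c \<in> R" "g \<in> S" shows "x + c * g \<in> gen_module R S"
proof -
  obtain n c' g' where x: "\<And>i::nat. i < n \<Longrightarrow> c' i \<in> R \<and> g' i \<in> S" "x = (\<Sum>i<n. c' i * g' i)"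
    using assms(1) unfolding gen_module_def by blast
  define c'' where "c'' = c'(n := c)"
  define g'' where "g'' = g'(n := g)"
  have "\<forall>i<Suc n. c'' i \<in> R \<and> g'' i \<in> S"
    using x(1) assms(2,3) by (simp add: c''_def g''_def less_Suc_eq)
  moreover have "x + c * g = (\<Sum>i<Suc n. c'' i * g'' i)"
    by (simp add: x(2) c''_def g''_def)
  ultimately show ?thesis unfolding gen_module_def by blast
qed

lemma gen_module_induct [consumes 1, case_names zero add]:
  assumes "x \<in> gen_module R S"
    and "P 0" and step: "\<And>x c g. P x \<Longrightarrow> c \<in> R \<Longrightarrow> g \<in> S \<Longrightarrow> P (x + c * g)"
  shows "P x"
proof -
  obtain n c g where x: "\<And>i::nat. i < n \<Longrightarrow> c i \<in> R \<and> g i \<in> S" "x = (\<Sum>i<n. c i * g i)"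
    using assms(1) unfolding gen_module_def by blast
  have "P (\<Sum>i<m. c i * g i)" if "m \<le> n" for m
    using that
  proof (induction m)
    case (Suc m)
    then show ?case using step[of "\<Sum>i<m. c i * g i" "c m" "g m"] x(1)[of m] by simp
  qed (simp add: assms(2))
  then show ?thesis using x(2) by blast
qed

context subring
begin

lemma gen_module_add:
  assumes "x \<in> gen_module S T" "y \<in> gen_module S T" shows "x + y \<in> gen_module S T"
  using assms(2)
proof (induction rule: gen_module_induct)
  case (add y c g)
  then show ?case using gen_module_add_term[of "x + y" S T c g] by (simp add: add.assoc)
qed (use assms in simp)

lemma gen_module_scale:
  assumes "x \<in> gen_module S T" "r \<in> S" shows "r * x \<in> gen_module S T"
  using assms(1)
proof (induction rule: gen_module_induct)
  case (add y c g)
  then show ?case using gen_module_add_term[of "r * y" S T "r * c" g] mult[OF assms(2)]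
    by (simp add: distrib_left mult.assoc)
qed (simp add: gen_module_0)

lemma gen_module_gen: "g \<in> T \<Longrightarrow> g \<in> gen_module S T"
  using gen_module_add_term[OF gen_module_0, of 1 S g T] by simp

lemma gen_module_least:
  assumes "T \<subseteq> gen_module S U" shows "gen_module S T \<subseteq> gen_module S U"
proof
  fix x assume "x \<in> gen_module S T"
  then show "x \<in> gen_module S U"
  proof (induction rule: gen_module_induct)
    case (add x c g)
    then show ?case using assms by (intro gen_module_add gen_module_scale) auto
  qed (rule gen_module_0)
qed

end

context vring
begin

text \<open>Of two generators one divides the other, so a combination collapses to one term. The
  generator depends on \<open>x\<close>; the ideal itself need not be principal.\<close>

lemma gen_module_principal:
  assumes "x \<in> gen_module R S" "S \<subseteq> F" "S \<noteq> {}"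
  shows "\<exists>c\<in>R. \<exists>g\<in>S. x = c * g"
  using assms(1)
proof (induction rule: gen_module_induct)
  case zero
  then show ?case using assms(3) zero by fastforce
next
  case (add x c g)
  then obtain d k where d: "d \<in> R" "k \<in> S" "x = d * k" by blast
  show ?case
  proof (cases "g = 0 \<or> k = 0")
    case True
    then show ?thesis
    proof
      assume "g = 0"
      then have "x + c * g = d * k" using d by simp
      then show ?thesis using d by blast
    next
      assume "k = 0"
      then have "x + c * g = c * g" using d by simp
      then show ?thesis using add by blast
    qed
  next
    case False
    have "g / k \<in> F" using d add assms(2) by (intro fld.divide) auto
    then consider "g / k \<in> R" | "k / g \<in> R" using total[of "g / k"] by auto
    then show ?thesis
    proof cases
      case 1
      then have "d + c * (g / k) \<in> R" using d add by (intro subring.add[OF subring_axioms] mult)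
      moreover have "x + c * g = (d + c * (g / k)) * k" using False d by (simp add: distrib_right)
      ultimately show ?thesis using d by blast
    next
      case 2
      then have "d * (k / g) + c \<in> R" using d add by (intro subring.add[OF subring_axioms] mult)
      moreover have "x + c * g = (d * (k / g) + c) * g" using False d by (simp add: distrib_right)
      ultimately show ?thesis using add by blast
    qed
  qed
qed

end

context kummer
begin

text \<open>All p-th roots of \<beta> ^ p differ from \<beta> by powers of \<zeta>, so adjoining
  them stays within L; recovering \<alpha> from \<beta> gives all of L.\<close>

lemma kummer_gensI:
  assumes \<beta>: "\<beta> \<in> L" "\<beta> \<noteq> 0" "\<beta> ^ p \<in> K"
    and \<alpha>: "\<And>F. subfield F \<Longrightarrow> K \<subseteq> F \<Longrightarrow> \<beta> \<in> F \<Longrightarrow> \<alpha> \<in> F"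
  shows "\<beta> ^ p \<in> kummer_gens K L p"
proof -
  define X where "X = {x. x ^ p = \<beta> ^ p}"
  have "X \<subseteq> L"
  proof
    fix x assume "x \<in> X"
    then have "(x / \<beta>) ^ p = 1" using \<beta> by (simp add: X_def power_divide)
    then obtain i where "x / \<beta> = \<zeta> ^ i" using root_of_unity by blast
    then have "x = \<zeta> ^ i * \<beta>" using \<beta> by (simp add: field_simps)
    then show "x \<in> L" using \<beta> \<zeta>K KL by (auto intro!: L.mult L.power)
  qed
  then have "adjoin K X \<subseteq> L" using L.subfield KL by (intro adjoin_least)
  moreover have "\<alpha> \<in> adjoin K X"
    using \<alpha>[OF adjoin_subfield adjoin_base] adjoin_gens[of X K] by (auto simp: X_def)
  then have "L \<subseteq> adjoin K X"
    unfolding L_def by (intro adjoin_least adjoin_subfield adjoin_base) simp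
  ultimately show ?thesis using \<beta>(3) by (auto simp: kummer_gens_def X_def)
qed

lemma kummer_gens_root:
  assumes "g \<in> kummer_gens K L p"
  shows "\<exists>\<beta>\<in>L. \<beta> \<notin> K \<and> \<beta> ^ p = g"
proof (rule ccontr)
  assume *: "\<not> ?thesis"
  have ad: "adjoin K {x. x ^ p = g} = L" using assms by (simp add: kummer_gens_def)
  then have "{x. x ^ p = g} \<subseteq> L" using adjoin_gens[of "{x. x ^ p = g}" K] by simp
  then have "{x. x ^ p = g} \<subseteq> K" using * by blast
  then have "adjoin K {x. x ^ p = g} \<subseteq> K" by (intro adjoin_least K.subfield subset_refl)
  then show False unfolding ad using \<alpha>L \<alpha>K by blast
qed

lemma kummer_root_\<sigma>:
  assumes "\<beta> \<in> L" "\<beta> \<notin> K" "\<beta> ^ p \<in> K"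
  shows "\<exists>\<omega>\<in>K. \<sigma> \<beta> = \<omega> * \<beta> \<and> \<omega> ^ p = 1 \<and> \<omega> \<noteq> 1"
proof -
  have \<beta>0: "\<beta> \<noteq> 0" using assms by auto
  have "\<sigma> \<beta> ^ p = \<beta> ^ p" using gal_power[OF \<sigma> assms(1), of p] gal_K[OF \<sigma> assms(3)] by simp
  then have "(\<sigma> \<beta> / \<beta>) ^ p = 1" using \<beta>0 by (simp add: power_divide)
  moreover from root_of_unity[OF this] have "\<sigma> \<beta> / \<beta> \<in> K" using \<zeta>K K.power by auto
  moreover have "\<sigma> \<beta> / \<beta> \<noteq> 1" using fixed_in_K assms(1,2) \<beta>0 by auto
  ultimately show ?thesis using \<beta>0 by (intro bexI[of _ "\<sigma> \<beta> / \<beta>"]) auto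
qed

end

context kummer_val
begin

lemma root_of_unity_A: assumes "x ^ p = 1" shows "x \<in> A"
proof -
  have "x \<in> K" using root_of_unity[OF assms] \<zeta>K K.power by auto
  moreover have "x = inverse x ^ (p - 1)"
  proof -
    have "x * x ^ (p - 1) = 1" using assms p_gt by (simp flip: power_Suc)
    then have "x * inverse (inverse x ^ (p - 1)) = 1" by (simp add: power_inverse)
    then show ?thesis by (metis inverse_inverse_eq inverse_unique)
  qed
  ultimately show ?thesis using A.total[of x] A.power[of "inverse x" "p - 1"] by auto
qed

text \<open>\<zeta> is a power of \<omega>, and a geometric sum is the quotient. It is used because
  \<sigma> may multiply a root of another Kummer generator by any primitive \<omega>, so the norm
  formula yields (\<omega> - 1)^p in place of (\<zeta> - 1)^p.\<close>

lemma \<zeta>_minus_1_dvd: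
  assumes "\<omega> ^ p = 1" "\<omega> \<noteq> 1" shows "\<exists>c\<in>A. \<zeta> - 1 = c * (\<omega> - 1)"
proof -
  obtain i where i: "i < p" "\<omega> = \<zeta> ^ i" using root_of_unity[OF assms(1)] by blast
  then have "\<not> p dvd i" using assms(2) \<zeta>_power_eq_1 by auto
  then obtain x y where "i * x = Suc (p * y)" using bezout_prime[OF p] by blast
  then have "\<omega> ^ x = \<zeta> ^ Suc (p * y)" unfolding i(2) by (simp flip: power_mult)
  then have "\<omega> ^ x = \<zeta>" by (simp add: power_mult \<zeta>p)
  then have "\<zeta> - 1 = (\<Sum>k<x. \<omega> ^ k) * (\<omega> - 1)"
    using power_diff_1_eq[of \<omega> x] by (simp add: mult.commute)
  moreover have "(\<Sum>k<x. \<omega> ^ k) \<in> A"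
    using root_of_unity_A[OF assms(1)] by (intro A.sum A.power)
  ultimately show ?thesis by blast
qed

section \<open>The two ideals and the inclusions between them\<close>

definition J where "J = gen_module B ((\<lambda>b. \<sigma> b / b - 1) ` (L - {0}))"

definition H where "H = gen_module A ((\<lambda>g. (\<zeta> - 1) ^ p / (g - 1)) ` kummer_gens K L p)"

lemma J_rep: assumes "x \<in> J" shows "\<exists>c\<in>B. \<exists>b\<in>L - {0}. x = c * (\<sigma> b / b - 1)"
proof -
  have 1: "(\<lambda>b. \<sigma> b / b - 1) ` (L - {0}) \<subseteq> L"
  proof (rule image_subsetI)
    fix b assume "b \<in> L - {0}"
    then have "\<sigma> b \<in> L" "b \<in> L" using gal_in[OF \<sigma>] by simp_all
    then show "\<sigma> b / b - 1 \<in> L" by (rule L.diff[OF L.divide L.one])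
  qed
  have 2: "(\<lambda>b. \<sigma> b / b - 1) ` (L - {0}) \<noteq> {}"
    using L.one by (metis Diff_iff image_is_empty empty_iff singletonD zero_neq_one)
  obtain c g where c: "c \<in> B" and g: "g \<in> (\<lambda>b. \<sigma> b / b - 1) ` (L - {0})" and x: "x = c * g"
    using B.gen_module_principal[OF assms[unfolded J_def] 1 2] by blast
  from g obtain b where "b \<in> L - {0}" "g = \<sigma> b / b - 1" by (rule imageE)
  with c x show ?thesis by blast
qed

lemma h_neq_1: "h \<noteq> 1"
proof
  assume "h = 1"
  then have "\<alpha> ^ p = 1" using \<alpha>p by simp
  then show False using root_of_unity \<alpha>K \<zeta>K K.power by blast
qed

lemma h_kummer: "h \<in> kummer_gens K L p"
  using kummer_gensI[of \<alpha>] \<alpha>L \<alpha>0 \<alpha>p hK by auto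

text \<open>These generators match the norms at \<alpha> - a, as h / (h - a ^ p) = - 1 / (a ^ p / h
  - 1). A root is a / \<alpha>, from which \<alpha> is recovered.\<close>

lemma twisted_h_kummer: assumes "a \<in> K" "a \<noteq> 0" shows "a ^ p / h \<in> kummer_gens K L p"
proof -
  have "(a / \<alpha>) ^ p \<in> kummer_gens K L p"
  proof (rule kummer_gensI)
    show "a / \<alpha> \<in> L" using assms KL \<alpha>L by (intro L.divide) auto
    show "a / \<alpha> \<noteq> 0" using assms \<alpha>0 by simp
    show "(a / \<alpha>) ^ p \<in> K" using assms hK by (simp add: power_divide \<alpha>p K.divide K.power)
    fix F assume F: "subfield F" "K \<subseteq> F" "a / \<alpha> \<in> F"
    then interpret F: subfield_set F by unfold_locales
    have "a / (a / \<alpha>) \<in> F" using F assms by (metis F.divide subsetD)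
    moreover have "a / (a / \<alpha>) = \<alpha>" using assms by simp
    ultimately show "\<alpha> \<in> F" by metis
  qed
  then show ?thesis by (simp add: power_divide \<alpha>p)
qed

lemma norm_linear_in_H:
  assumes a: "a \<in> K" shows "N (\<sigma> (\<alpha> - a) / (\<alpha> - a) - 1) \<in> H"
proof -
  have "\<zeta> \<noteq> 1" using \<zeta>_prim[of 1] p_gt by auto
  then have N: "N (\<sigma> (\<alpha> - a) / (\<alpha> - a) - 1) = (\<zeta> - 1) ^ p * (h / (h - a ^ p))"
    using norm_quotient[OF \<alpha>L \<zeta>K \<sigma>\<alpha> \<zeta>p _ a] a \<alpha>K \<alpha>p by auto
  have gen: "(\<zeta> - 1) ^ p / (g - 1) \<in> H" if "g \<in> kummer_gens K L p" for g
    unfolding H_def using that by (intro A.gen_module_gen) auto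
  have scale: "r * x \<in> H" if "x \<in> H" "r \<in> A" for r x
    using that A.gen_module_scale unfolding H_def by blast
  show ?thesis
  proof (cases "a = 0")
    case False
    have "h / (h - a ^ p) = - 1 * (1 / (a ^ p / h - 1))"
      using h0 by (simp add: divide_simps) (simp add: algebra_simps)
    then have "N (\<sigma> (\<alpha> - a) / (\<alpha> - a) - 1) = - 1 * ((\<zeta> - 1) ^ p / (a ^ p / h - 1))"
      unfolding N by simp
    then show ?thesis using scale[OF gen[OF twisted_h_kummer[OF a False]], of "- 1"] A.minus by simp
  next
    case True
    then have N': "N (\<sigma> (\<alpha> - a) / (\<alpha> - a) - 1) = (\<zeta> - 1) ^ p"
      using N p_gt h0 by (simp add: power_0_left)
    \<comment> \<open>The norm (\<zeta> - 1)^p is g - 1 times a generator of \<open>H\<close>, so a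
      Kummer generator in A other than 1 is wanted. One of h and 1 / h will do, the latter being the
      twist by a = 1.\<close>
    have "\<exists>g\<in>kummer_gens K L p. g \<in> A \<and> g \<noteq> 1"
    proof (cases "h \<in> A")
      case True
      then show ?thesis using h_kummer h_neq_1 by blast
    next
      case False
      then have "1 ^ p / h \<in> A" using A.total[OF hK] by (simp add: divide_inverse)
      then show ?thesis using twisted_h_kummer[of 1] h_neq_1 h0 K.one by (intro bexI[of _ "1 ^ p / h"]) auto
    qed
    then obtain g where g: "g \<in> kummer_gens K L p" "g \<in> A" "g \<noteq> 1" by blast
    then have "(g - 1) * ((\<zeta> - 1) ^ p / (g - 1)) \<in> H" by (intro scale gen A.diff A.one)
    then show ?thesis unfolding N' using g(3) by simp
  qed
qed

lemma norm_J_in_H: assumes "x \<in> J" shows "N x \<in> H"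
proof -
  obtain c b where c: "c \<in> B" and b: "b \<in> L" "b \<noteq> 0" and x: "x = c * (\<sigma> b / b - 1)"
    using J_rep[OF assms] by blast
  obtain a d where a: "a \<in> K" and d: "d \<in> B" and b_eq: "\<sigma> b / b - 1 = d * (\<sigma> (\<alpha> - a) / (\<alpha> - a) - 1)"
    using ratio_dominated[OF b] by blast
  have "\<alpha> - a \<in> L" using \<alpha>L a KL by (auto intro: L.diff)
  then have yL: "\<sigma> (\<alpha> - a) / (\<alpha> - a) - 1 \<in> L"
    using gal_in[OF \<sigma>] by (intro L.diff[OF L.divide L.one]) auto
  have "N x = N (c * d) * N (\<sigma> (\<alpha> - a) / (\<alpha> - a) - 1)"
    unfolding x b_eq mult.assoc[symmetric] using c d yL B.sub by (intro norm_mult L.mult) auto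
  then show ?thesis
    using A.gen_module_scale[OF norm_linear_in_H[OF a, unfolded H_def] norm_A[OF B.mult[OF c d]]]
    unfolding H_def by simp
qed

lemma H_gen_in_norms:
  assumes g: "g \<in> kummer_gens K L p"
  shows "(\<zeta> - 1) ^ p / (g - 1) \<in> gen_module A (N ` J)"
proof -
  obtain \<beta> where \<beta>: "\<beta> \<in> L" "\<beta> \<notin> K" "\<beta> ^ p = g" using kummer_gens_root[OF g] by blast
  have gK: "g \<in> K" using g by (simp add: kummer_gens_def)
  have \<beta>0: "\<beta> \<noteq> 0" using \<beta> by auto
  then have g0: "g \<noteq> 0" using \<beta> by auto
  \<comment> \<open>The reciprocal gives the norm formula the right shape: with 1 / g for g and c =
    1 its second factor is - 1 / (g - 1).\<close>
  define \<gamma> where "\<gamma> = inverse \<beta>"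
  have \<gamma>L: "\<gamma> \<in> L" unfolding \<gamma>_def using \<beta> by (intro L.inverse)
  have \<gamma>K: "\<gamma> \<notin> K" using K.inverse[of \<gamma>] \<beta> by (auto simp: \<gamma>_def)
  have \<gamma>p: "\<gamma> ^ p = inverse g" using \<beta> by (simp add: \<gamma>_def power_inverse)
  then have "\<gamma> ^ p \<in> K" using gK K.inverse by simp
  then obtain \<omega> where \<omega>: "\<omega> \<in> K" "\<sigma> \<gamma> = \<omega> * \<gamma>" "\<omega> ^ p = 1" "\<omega> \<noteq> 1"
    using kummer_root_\<sigma>[OF \<gamma>L \<gamma>K] by blast
  obtain c where c: "c \<in> A" "\<zeta> - 1 = c * (\<omega> - 1)" using \<zeta>_minus_1_dvd[OF \<omega>(3,4)] by blast
  define x where "x = \<sigma> (\<gamma> - 1) / (\<gamma> - 1) - 1"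
  have "\<gamma> \<noteq> 1" using \<gamma>K by auto
  then have Nx: "N x = (\<omega> - 1) ^ p * (inverse g / (inverse g - 1))"
    using norm_quotient[OF \<gamma>L \<omega> K.one] \<gamma>p by (simp add: x_def)
  have "inverse g / (inverse g - 1) = - (1 / (g - 1))"
    using g0 by (simp add: divide_simps)
  then have "(\<zeta> - 1) ^ p / (g - 1) = - (c ^ p) * N x"
    unfolding Nx c(2) by (simp add: power_mult_distrib)
  moreover have "x \<in> J"
    unfolding J_def x_def using \<gamma>L \<open>\<gamma> \<noteq> 1\<close> L.diff by (intro B.gen_module_gen) auto
  then have "N x \<in> gen_module A (N ` J)" by (intro A.gen_module_gen) auto
  then have "- (c ^ p) * N x \<in> gen_module A (N ` J)"
    using c(1) by (intro A.gen_module_scale A.minus A.power)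
  ultimately show ?thesis by simp
qed

lemma H_eq: "H = gen_module A (N ` J)"
proof
  show "H \<subseteq> gen_module A (N ` J)"
    unfolding H_def using H_gen_in_norms by (intro A.gen_module_least) auto
  show "gen_module A (N ` J) \<subseteq> H"
    using norm_J_in_H unfolding H_def by (intro A.gen_module_least) auto
qed

end

theorem theorem1p3:
  fixes K A L B :: "'a::field_char_0 set" and p :: nat and \<zeta> \<alpha> h :: 'a and \<sigma> :: "'a \<Rightarrow> 'a"
  assumes "valuation_ring K A" and "henselian A"
    and "prime p" and "of_nat p \<in> max_ideal A"
    and "\<zeta> \<in> K" and "\<zeta> ^ p = 1" and "\<forall>k. 0 < k \<and> k < p \<longrightarrow> \<zeta> ^ k \<noteq> 1"
    and "h \<in> K" and "h \<noteq> 0" and "\<alpha> ^ p = h" and "\<alpha> \<notin> K"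
    and "L = adjoin K {\<alpha>}"
    and "B = int_closure A L"
    and "\<sigma> \<in> gal K L" and "\<sigma> \<alpha> = \<zeta> * \<alpha>"
  shows "gen_module A ((\<lambda>g. (\<zeta> - 1) ^ p / (g - 1)) ` kummer_gens K L p)
       = gen_module A (field_norm K L ` gen_module B ((\<lambda>b. \<sigma> b / b - 1) ` (L - {0})))"
proof -
  interpret kummer_val K L p \<zeta> \<alpha> h \<sigma> A B
    using assms by unfold_locales (auto simp: valuation_ring_def)
  show ?thesis using H_eq unfolding H_def J_def .
qed

end
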